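(* Let $G$ be a finite, simple, connected graph of order $n$ and diameter $2$, and let $G^*$ be its twin graph. Then $\beta(G)=n-3$ if and only if $G^*$, together with the types of its vertices, has one of the following structures: $G_1$: $G^*\cong K_3$ and at most one vertex of $G^*$ is of type (1K). $G_2$: $G^*\cong P_3$ and either (a) the degree-$2$ vertex is of type (N), one leaf is of type (K) and the other leaf is of any type; or (b) one leaf is of type (K), the other leaf is of type (KN), and the degree-$2$ vertex is of any type. $G_3$: $G^*$ is the paw (a triangle with a pendant edge); the degree-$3$ vertex is of any type, one of the degree-$2$ vertices is of type (N), the other degree-$2$ vertex is of type (1K), and the leaf is of type (1N); moreover, if a degree-$2$ vertex is of type (K), then neither the leaf nor the degree-$3$ vertex is of type (N). $G_4$: $G^*\cong C_5$ and every vertex is of type (1). $G_5$: $G^*$ is $C_5$ with one chord; the two adjacent degree-$2$ vertices are of type (1) and the other three vertices are of type (1K). $G_6$: $G^*$ is $C_5$ with two chords sharing an endpoint (so one vertex has degree $4$); the degree-$4$ vertex is of any type and all other vertices are of type (1K); furthermore, no two non-adjacent vertices are both of type (K), and no two adjacent vertices are such that one is of type (K) and the other of type (N). $G_7$: $G^*$ is the kite ($K_4$ minus an edge) with a pendant edge attached to one of its degree-$3$ vertices; the leaf is of type (1), the degree-$4$ vertex and the (remaining) degree-$3$ vertex are of type (1K), and of the two degree-$2$ vertices one is of type (K) and the other of type (1). $G_8$: $G^*$ is the kite; of the two degree-$2$ vertices one is of type (K) and the other of type (1), and of the two degree-$3$ vertices one is of type (N) and the other of type (1K). $G_9$: $G^*\cong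 C_4$, two adjacent vertices are of type (K), and the other two are of type (1). $G_{10}$: $G^*\cong C_4\vee K_1$; two adjacent degree-$3$ vertices are of type (K), the degree-$4$ vertex is of type (1K), and the remaining two vertices are of type (1).
   Context: For an ordered set $W=\{w_1,\dots,w_k\}$ of vertices of a connected graph $G$ and a vertex $v$, $r(v|W)=(d(v,w_1),\dots,d(v,w_k))$, where $d$ is the shortest-path distance. $W$ is a resolving set if distinct vertices have distinct vectors $r(\cdot|W)$; the metric dimension $\beta(G)$ is the minimum size of a resolving set. Two distinct vertices $u,v$ are twins if $N(v)\setminus\{u\}=N(u)\setminus\{v\}$ (open neighbourhoods); $u\equiv v$ iff $u=v$ or $u,v$ are twins; this is an equivalence relation, and the class of $v$ is denoted $v^*$. The twin graph $G^*$ has vertex set $\{v^*: v\in V(G)\}$, with $u^*v^*$ an edge iff $uv\in E(G)$ (well defined). Each class $v^*$ induces a complete or an empty graph. A vertex $v^*$ of $G^*$ is of type (1) if $|v^*|=1$, of type (K) if $G[v^*]\cong K_r$ with $r\ge 2$, and of type (N) if $G[v^*]$ is the edgeless graph on $r\ge 2$ vertices. Type (1K) means type (1) or (K); (1N) means (1) or (N); (KN) means (K) or (N). The paw is a triangle with one pendant edge; the kite is $K_4$ minus one edge; $\vee$ denotes the join. *)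

theory Defs
  imports Main
begin

definition simple_graph :: "'a set \<Rightarrow> ('a \<Rightarrow> 'a \<Rightarrow> bool) \<Rightarrow> bool" where
  "simple_graph V E \<longleftrightarrow> finite V \<and> (\<forall>u v. E u v \<longrightarrow> u \<in> V \<and> v \<in> V)
     \<and> (\<forall>u v. E u v \<longrightarrow> E v u) \<and> (\<forall>u. \<not> E u u)"

fun walk_len :: "('a \<Rightarrow> 'a \<Rightarrow> bool) \<Rightarrow> nat \<Rightarrow> 'a \<Rightarrow> 'a \<Rightarrow> bool" where
  "walk_len E 0 u v = (u = v)"
| "walk_len E (Suc k) u v = (\<exists>w. E u w \<and> walk_len E k w v)"

definition connected_graph :: "'a set \<Rightarrow> ('a \<Rightarrow> 'a \<Rightarrow> bool) \<Rightarrow> bool" where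
  "connected_graph V E \<longleftrightarrow> V \<noteq> {} \<and> (\<forall>u\<in>V. \<forall>v\<in>V. \<exists>k. walk_len E k u v)"

definition gdist :: "('a \<Rightarrow> 'a \<Rightarrow> bool) \<Rightarrow> 'a \<Rightarrow> 'a \<Rightarrow> nat" where
  "gdist E u v = (LEAST k. walk_len E k u v)"

definition diameter_two :: "'a set \<Rightarrow> ('a \<Rightarrow> 'a \<Rightarrow> bool) \<Rightarrow> bool" where
  "diameter_two V E \<longleftrightarrow> (\<forall>u\<in>V. \<forall>v\<in>V. gdist E u v \<le> 2) \<and> (\<exists>u\<in>V. \<exists>v\<in>V. gdist E u v = 2)"

definition resolving :: "'a set \<Rightarrow> ('a \<Rightarrow> 'a \<Rightarrow> bool) \<Rightarrow> 'a set \<Rightarrow> bool" where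
  "resolving V E W \<longleftrightarrow> W \<subseteq> V \<and>
     (\<forall>u\<in>V. \<forall>v\<in>V. u \<noteq> v \<longrightarrow> (\<exists>w\<in>W. gdist E u w \<noteq> gdist E v w))"

definition metric_dim :: "'a set \<Rightarrow> ('a \<Rightarrow> 'a \<Rightarrow> bool) \<Rightarrow> nat" where
  "metric_dim V E = Min {card W | W. resolving V E W}"

definition nbhd :: "('a \<Rightarrow> 'a \<Rightarrow> bool) \<Rightarrow> 'a \<Rightarrow> 'a set" where
  "nbhd E v = {u. E v u}"

definition twins :: "('a \<Rightarrow> 'a \<Rightarrow> bool) \<Rightarrow> 'a \<Rightarrow> 'a \<Rightarrow> bool" where
  "twins E u v \<longleftrightarrow> u \<noteq> v \<and> nbhd E v - {u} = nbhd E u - {v}"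

definition twin_class :: "'a set \<Rightarrow> ('a \<Rightarrow> 'a \<Rightarrow> bool) \<Rightarrow> 'a \<Rightarrow> 'a set" where
  "twin_class V E v = {u\<in>V. u = v \<or> twins E u v}"

definition twin_vertices :: "'a set \<Rightarrow> ('a \<Rightarrow> 'a \<Rightarrow> bool) \<Rightarrow> 'a set set" where
  "twin_vertices V E = twin_class V E ` V"

definition twin_adj :: "('a \<Rightarrow> 'a \<Rightarrow> bool) \<Rightarrow> 'a set \<Rightarrow> 'a set \<Rightarrow> bool" where
  "twin_adj E X Y \<longleftrightarrow> X \<noteq> Y \<and> (\<exists>u\<in>X. \<exists>v\<in>Y. E u v)"

definition type1 :: "'a set \<Rightarrow> bool" where
  "type1 X \<longleftrightarrow> card X = 1"
definition typeK :: "('a \<Rightarrow> 'a \<Rightarrow> bool) \<Rightarrow> 'a set \<Rightarrow> bool" where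
  "typeK E X \<longleftrightarrow> card X \<ge> 2 \<and> (\<forall>u\<in>X. \<forall>v\<in>X. u \<noteq> v \<longrightarrow> E u v)"
definition typeN :: "('a \<Rightarrow> 'a \<Rightarrow> bool) \<Rightarrow> 'a set \<Rightarrow> bool" where
  "typeN E X \<longleftrightarrow> card X \<ge> 2 \<and> (\<forall>u\<in>X. \<forall>v\<in>X. \<not> E u v)"
definition type1K :: "('a \<Rightarrow> 'a \<Rightarrow> bool) \<Rightarrow> 'a set \<Rightarrow> bool" where
  "type1K E X \<longleftrightarrow> type1 X \<or> typeK E X"
definition type1N :: "('a \<Rightarrow> 'a \<Rightarrow> bool) \<Rightarrow> 'a set \<Rightarrow> bool" where
  "type1N E X \<longleftrightarrow> type1 X \<or> typeN E X"
definition typeKN :: "('a \<Rightarrow> 'a \<Rightarrow> bool) \<Rightarrow> 'a set \<Rightarrow> bool" where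
  "typeKN E X \<longleftrightarrow> typeK E X \<or> typeN E X"

definition pat_adj :: "(nat \<times> nat) list \<Rightarrow> nat \<Rightarrow> nat \<Rightarrow> bool" where
  "pat_adj es i j \<longleftrightarrow> (i, j) \<in> set es \<or> (j, i) \<in> set es"

definition twin_iso :: "'a set \<Rightarrow> ('a \<Rightarrow> 'a \<Rightarrow> bool) \<Rightarrow> nat \<Rightarrow> (nat \<times> nat) list \<Rightarrow> (nat \<Rightarrow> 'a set) \<Rightarrow> bool" where
  "twin_iso V E k es f \<longleftrightarrow> bij_betw f {0..<k} (twin_vertices V E) \<and>
     (\<forall>i<k. \<forall>j<k. twin_adj E (f i) (f j) \<longleftrightarrow> pat_adj es i j)"

definition K3_es :: "(nat \<times> nat) list" where "K3_es = [(0,1),(1,2),(0,2)]"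
definition P3_es :: "(nat \<times> nat) list" where "P3_es = [(0,1),(1,2)]"
definition paw_es :: "(nat \<times> nat) list" where "paw_es = [(0,1),(1,2),(0,2),(2,3)]"
  (* degree-3 vertex: 2; degree-2 vertices: 0,1; leaf: 3 *)
definition C5_es :: "(nat \<times> nat) list" where "C5_es = [(0,1),(1,2),(2,3),(3,4),(4,0)]"
definition C5c_es :: "(nat \<times> nat) list" where "C5c_es = C5_es @ [(0,2)]"
  (* adjacent degree-2 vertices: 3,4 *)
definition C5cc_es :: "(nat \<times> nat) list" where "C5cc_es = C5_es @ [(0,2),(0,3)]"
definition kite_es :: "(nat \<times> nat) list" where "kite_es = [(0,2),(0,3),(1,2),(1,3),(2,3)]"
  (* degree-2 vertices: 0,1; degree-3 vertices: 2,3 *)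
definition kitep_es :: "(nat \<times> nat) list" where "kitep_es = kite_es @ [(2,4)]"
  (* leaf 4, degree-4 vertex 2, remaining degree-3 vertex 3, degree-2 vertices 0,1 *)
definition C4_es :: "(nat \<times> nat) list" where "C4_es = [(0,1),(1,2),(2,3),(3,0)]"
definition C4K1_es :: "(nat \<times> nat) list" where
  "C4K1_es = C4_es @ [(0,4),(1,4),(2,4),(3,4)]"

definition struct_G1 where
  "struct_G1 V E \<longleftrightarrow> (\<exists>f. twin_iso V E 3 K3_es f \<and> card {i\<in>{0..<3}. type1K E (f i)} \<le> 1)"

definition struct_G2 where
  "struct_G2 V E \<longleftrightarrow> (\<exists>f. twin_iso V E 3 P3_es f \<and>
     ((typeN E (f 1) \<and> typeK E (f 0)) \<or> (typeK E (f 0) \<and> typeKN E (f 2))))"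

definition struct_G3 where
  "struct_G3 V E \<longleftrightarrow> (\<exists>f. twin_iso V E 4 paw_es f \<and>
     typeN E (f 0) \<and> type1K E (f 1) \<and> type1N E (f 3) \<and>
     ((typeK E (f 0) \<or> typeK E (f 1)) \<longrightarrow> \<not> typeN E (f 3) \<and> \<not> typeN E (f 2)))"

definition struct_G4 where
  "struct_G4 V E \<longleftrightarrow> (\<exists>f. twin_iso V E 5 C5_es f \<and> (\<forall>i<5. type1 (f i)))"

definition struct_G5 where
  "struct_G5 V E \<longleftrightarrow> (\<exists>f. twin_iso V E 5 C5c_es f \<and>
     type1 (f 3) \<and> type1 (f 4) \<and> type1K E (f 0) \<and> type1K E (f 1) \<and> type1K E (f 2))"

definition struct_G6 where
  "struct_G6 V E \<longleftrightarrow> (\<exists>f. twin_iso V E 5 C5cc_es f \<and>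
     (\<forall>i\<in>{1,2,3,4}. type1K E (f i)) \<and>
     (\<forall>i<5. \<forall>j<5. i \<noteq> j \<and> \<not> pat_adj C5cc_es i j \<longrightarrow> \<not> (typeK E (f i) \<and> typeK E (f j))) \<and>
     (\<forall>i<5. \<forall>j<5. pat_adj C5cc_es i j \<longrightarrow> \<not> (typeK E (f i) \<and> typeN E (f j))))"

definition struct_G7 where
  "struct_G7 V E \<longleftrightarrow> (\<exists>f. twin_iso V E 5 kitep_es f \<and>
     type1 (f 4) \<and> type1K E (f 2) \<and> type1K E (f 3) \<and> typeK E (f 0) \<and> type1 (f 1))"

definition struct_G8 where
  "struct_G8 V E \<longleftrightarrow> (\<exists>f. twin_iso V E 4 kite_es f \<and>
     typeK E (f 0) \<and> type1 (f 1) \<and> typeN E (f 2) \<and> type1K E (f 3))"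

definition struct_G9 where
  "struct_G9 V E \<longleftrightarrow> (\<exists>f. twin_iso V E 4 C4_es f \<and>
     typeK E (f 0) \<and> typeK E (f 1) \<and> type1 (f 2) \<and> type1 (f 3))"

definition struct_G10 where
  "struct_G10 V E \<longleftrightarrow> (\<exists>f. twin_iso V E 5 C4K1_es f \<and>
     typeK E (f 0) \<and> typeK E (f 1) \<and> type1K E (f 4) \<and> type1 (f 2) \<and> type1 (f 3))"

end

(*
  In a graph of diameter two the distance between distinct vertices only records adjacency, so a
  set W is resolving iff distinct vertices of S = V - W are told apart by adjacency to a vertex of W.
  Hence the metric dimension is n - 3 iff there is such a "co-resolving" set S with three elements
  but none with four. Whether there is one with m elements depends only on the twin graph and the
  types of its vertices, which settles the ten structures by a finite computation.

  Conversely, a co-resolving triple is told apart by two vertices x, y outside it. Classify the other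
  vertices by their adjacency to x and y: a fourth class would give a co-resolving set with four
  elements, so there are exactly three cells. If two vertices u, v of one cell are told apart by a
  vertex w other than x and y, then u, v and vertices of the other two cells are co-resolving, unless
  one of those cells is {w}. So the adjacencies are constant on cells up to a splitting of cells by
  one-element cells; this leaves finitely many graphs up to the sizes of twin sets, and each of them
  has diameter greater than two, or has a co-resolving 4-set, or has one of the ten structures.
*)
theory Submission
  imports Defs
begin

text \<open>Class sizes are unbounded, yet the computation is finite because only "one vertex"
  against "at least two" matters. A co-resolving set takes at most one vertex from a set of mutual
  twins, and such a set can still supply a witness from outside exactly when it has a vertex left
  over. Hence three types per class suffice in one direction, and three sizes (none, one, more) per
  part of a cell in the other.

  The obstacle in the converse is that cells and their parts need not be twin classes: a probing
  vertex may be a twin of a cell vertex, and parts of different cells may be twins of each other.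
  The notion of a slotting is therefore weaker than the twin partition: it asks only for constant
  adjacency inside and between pieces. Co-resolving sets can already be computed from it, and the
  twin graph appears after merging twin pieces. That one pass of merging removes all twins is part
  of what is evaluated for each candidate, not a general fact about merging.\<close>

section \<open>Co-resolving sets\<close>

definition co_resolving :: "'a set \<Rightarrow> ('a \<Rightarrow> 'a \<Rightarrow> bool) \<Rightarrow> 'a set \<Rightarrow> bool" where
  "co_resolving V E S \<longleftrightarrow> S \<subseteq> V \<and> (\<forall>u\<in>S. \<forall>v\<in>S. u \<noteq> v \<longrightarrow> (\<exists>w\<in>V - S. E u w \<noteq> E v w))"

text \<open>Shrinking the set enlarges the supply \<open>V - S\<close> of witnesses.\<close>

lemma co_resolving_subset:
  assumes "co_resolving V E S" "T \<subseteq> S"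
  shows "co_resolving V E T"
  using assms unfolding co_resolving_def by blast

section \<open>Graphs of diameter two and complements of resolving sets\<close>

locale sgraph =
  fixes V :: "'a set" and E :: "'a \<Rightarrow> 'a \<Rightarrow> bool"
  assumes simple: "simple_graph V E"
begin

lemma finite_V: "finite V"
  and adj_in_V: "E u v \<Longrightarrow> u \<in> V" "E u v \<Longrightarrow> v \<in> V"
  and adj_sym: "E u v \<longleftrightarrow> E v u"
  and adj_irrefl: "\<not> E u u"
  using simple unfolding simple_graph_def by blast+

lemma twins_iff: "twins E u v \<longleftrightarrow> u \<noteq> v \<and> (\<forall>w. w \<noteq> u \<longrightarrow> w \<noteq> v \<longrightarrow> E u w = E v w)"
  unfolding twins_def nbhd_def set_eq_iff using adj_irrefl by (auto; metis)

end

locale diam2_graph = sgraph +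
  assumes connected: "connected_graph V E" and diam2: "diameter_two V E"
begin

lemma gdist_eq:
  assumes "u \<in> V" "v \<in> V"
  shows "gdist E u v = (if u = v then 0 else if E u v then 1 else 2)"
proof -
  have ex: "\<exists>k. walk_len E k u v"
    using connected assms unfolding connected_graph_def by blast
  have walk: "walk_len E (gdist E u v) u v"
    unfolding gdist_def by (rule LeastI_ex[OF ex])
  have le: "gdist E u v \<le> k" if "walk_len E k u v" for k
    unfolding gdist_def using that by (rule Least_le)
  have "gdist E u v \<le> 2"
    using diam2 assms unfolding diameter_two_def by blast
  then consider "gdist E u v = 0" | "gdist E u v = 1" | "gdist E u v = 2"
    by linarith
  then show ?thesis
    using walk le[of 0] le[of 1] by cases auto
qed

lemma common_neighbour:
  assumes "u \<in> V" "v \<in> V" "u \<noteq> v" "\<not> E u v"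
  obtains w where "E u w" "E w v"
proof -
  have "\<exists>k. walk_len E k u v"
    using connected assms unfolding connected_graph_def by blast
  then have "walk_len E (gdist E u v) u v"
    unfolding gdist_def by (rule LeastI_ex)
  moreover have "gdist E u v = Suc (Suc 0)"
    using gdist_eq[of u v] assms by simp
  ultimately show ?thesis
    using that by auto
qed

text \<open>Subtraction on naturals is truncated; this bound lets
  \<open>card V - 3 = card V - card S\<close> be cancelled to \<open>card S = 3\<close>.\<close>

lemma card_V_ge_3: "card V \<ge> 3"
proof -
  obtain u v where uv: "u \<in> V" "v \<in> V" "gdist E u v = 2"
    using diam2 unfolding diameter_two_def by blast
  then have ne: "u \<noteq> v" "\<not> E u v"
    using gdist_eq[of u v] by (auto split: if_splits)
  then obtain w where w: "E u w" "E w v"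
    using common_neighbour uv by metis
  then have "u \<noteq> w" "v \<noteq> w"
    using ne adj_irrefl adj_sym by metis+
  then have "card {u, v, w} = 3"
    using ne by simp
  moreover have "{u, v, w} \<subseteq> V"
    using uv w adj_in_V by blast
  ultimately show ?thesis
    by (metis card_mono finite_V)
qed

text \<open>A pair with a member in \<open>W\<close> is resolved by that member, which is at
  distance 0 from itself only. For the other pairs every distance to \<open>W\<close> is 1 or 2, so
  distances differ exactly when adjacencies do.\<close>

lemma resolving_iff_co_resolving:
  assumes "W \<subseteq> V"
  shows "resolving V E W \<longleftrightarrow> co_resolving V E (V - W)"
proof
  assume res: "resolving V E W"
  show "co_resolving V E (V - W)"
    unfolding co_resolving_def
  proof (intro conjI ballI impI)
    fix u v assume uv: "u \<in> V - W" "v \<in> V - W" "u \<noteq> v"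
    then obtain w where w: "w \<in> W" "gdist E u w \<noteq> gdist E v w"
      using res unfolding resolving_def by blast
    then have "E u w \<noteq> E v w"
      using uv assms gdist_eq[of u w] gdist_eq[of v w] by (auto split: if_splits)
    then show "\<exists>w\<in>V - (V - W). E u w \<noteq> E v w"
      using w assms by blast
  qed simp
next
  assume co: "co_resolving V E (V - W)"
  show "resolving V E W"
    unfolding resolving_def
  proof (intro conjI ballI impI assms)
    fix u v assume uv: "u \<in> V" "v \<in> V" "u \<noteq> v"
    consider "u \<in> W" | "v \<in> W" | "u \<in> V - W" "v \<in> V - W"
      using uv by blast
    then show "\<exists>w\<in>W. gdist E u w \<noteq> gdist E v w"
    proof cases
      case 1
      then show ?thesis using uv gdist_eq[of u u] gdist_eq[of v u] by (intro bexI[of _ u]) auto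
    next
      case 2
      then show ?thesis using uv gdist_eq[of u v] gdist_eq[of v v] by (intro bexI[of _ v]) auto
    next
      case 3
      then obtain w where w: "w \<in> V - (V - W)" "E u w \<noteq> E v w"
        using co uv unfolding co_resolving_def by blast
      then have "u \<noteq> w" "v \<noteq> w"
        using 3 by auto
      then show ?thesis
        using w uv gdist_eq[of u w] gdist_eq[of v w] by (intro bexI[of _ w]) auto
    qed
  qed
qed

text \<open>Co-resolving sets are closed under subsets, so a larger one would contain one of size
  four; excluding that single size bounds them all by three.\<close>

lemma metric_dim_iff:
  "metric_dim V E = card V - 3 \<longleftrightarrow>
    (\<exists>S. co_resolving V E S \<and> card S = 3) \<and> \<not> (\<exists>S. co_resolving V E S \<and> card S = 4)"
proof -
  define R where "R = {card W | W. resolving V E W}"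
  have R_eq: "R = (\<lambda>S. card V - card S) ` {S. co_resolving V E S}" (is "R = ?R'")
  proof (intro equalityI subsetI)
    fix r assume "r \<in> R"
    then obtain W where W: "W \<subseteq> V" "resolving V E W" "r = card W"
      unfolding R_def resolving_def by blast
    have "r = card V - card (V - W)"
      using W card_mono[OF finite_V, of W] finite_subset[OF _ finite_V]
      by (simp add: card_Diff_subset)
    then show "r \<in> ?R'"
      using W resolving_iff_co_resolving by blast
  next
    fix r assume "r \<in> ?R'"
    then obtain S where S: "co_resolving V E S" "r = card V - card S"
      by blast
    have "S \<subseteq> V"
      using S unfolding co_resolving_def by blast
    then have "V - (V - S) = S" "r = card (V - S)"
      using S finite_subset[OF _ finite_V] by (auto simp: card_Diff_subset)
    then show "r \<in> R"
      unfolding R_def using S resolving_iff_co_resolving[of "V - S"] by auto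
  qed
  have card_le: "card S \<le> card V" if "co_resolving V E S" for S
    using that card_mono[OF finite_V] unfolding co_resolving_def by blast
  have "finite R"
    unfolding R_eq by (rule finite_subset[of _ "{..card V}"]) auto
  \<comment> \<open>The empty set corresponds to \<open>W = V\<close>; it makes \<open>R\<close>
    nonempty, as \<open>Min\<close> requires.\<close>
  moreover have "co_resolving V E {}"
    unfolding co_resolving_def by simp
  then have "R \<noteq> {}"
    unfolding R_eq by blast
  ultimately have "Min R = card V - 3 \<longleftrightarrow> card V - 3 \<in> R \<and> (\<forall>r\<in>R. card V - 3 \<le> r)"
    by (rule Min_eq_iff)
  also have "card V - 3 \<in> R \<longleftrightarrow> (\<exists>S. co_resolving V E S \<and> card S = 3)"
  proof
    assume "card V - 3 \<in> R"
    then obtain S where S: "co_resolving V E S" "card V - 3 = card V - card S"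
      unfolding R_eq by blast
    then have "card S = 3"
      using card_le[OF S(1)] card_V_ge_3 by linarith
    then show "\<exists>S. co_resolving V E S \<and> card S = 3"
      using S by blast
  next
    assume "\<exists>S. co_resolving V E S \<and> card S = 3"
    then show "card V - 3 \<in> R"
      unfolding R_eq by (metis (mono_tags, lifting) imageI mem_Collect_eq)
  qed
  also have "(\<forall>r\<in>R. card V - 3 \<le> r) \<longleftrightarrow> \<not> (\<exists>S. co_resolving V E S \<and> card S = 4)"
  proof
    assume le: "\<forall>r\<in>R. card V - 3 \<le> r"
    show "\<not> (\<exists>S. co_resolving V E S \<and> card S = 4)"
    proof
      assume "\<exists>S. co_resolving V E S \<and> card S = 4"
      then obtain S where S: "co_resolving V E S" "card S = 4"
        by blast
      then have "card V - 3 \<le> card V - card S"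
        using le unfolding R_eq by blast
      then show False
        using S(2) card_le[OF S(1)] by linarith
    qed
  next
    assume no4: "\<not> (\<exists>S. co_resolving V E S \<and> card S = 4)"
    have "card S \<le> 3" if "co_resolving V E S" for S
    proof (rule ccontr)
      assume "\<not> card S \<le> 3"
      then obtain T where "T \<subseteq> S" "card T = 4"
        using obtain_subset_with_card_n[of 4 S] by auto
      then show False
        using no4 co_resolving_subset[OF that] by blast
    qed
    then show "\<forall>r\<in>R. card V - 3 \<le> r"
      unfolding R_eq by (auto intro: diff_le_mono2)
  qed
  finally show ?thesis
    unfolding metric_dim_def R_def .
qed

end

section \<open>Partitions into typed slots\<close>

datatype ctype = One | Many bool

definition class_type :: "('a \<Rightarrow> 'a \<Rightarrow> bool) \<Rightarrow> 'a set \<Rightarrow> ctype" where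
  "class_type E M = (if card M = 1 then One else Many (\<forall>u\<in>M. \<forall>v\<in>M. u \<noteq> v \<longrightarrow> E u v))"

text \<open>The sets \<^term>\<open>X i\<close> for the keys \<^term>\<open>i\<close> of \<^term>\<open>sl\<close> partition \<^term>\<open>V\<close> into pieces on which
adjacency is constant, and between which it is given by \<^term>\<open>adj\<close>. The diagonal values of \<^term>\<open>adj\<close> are
irrelevant: adjacency inside a piece is recorded by its type.\<close>

definition slotting :: "'a set \<Rightarrow> ('a \<Rightarrow> 'a \<Rightarrow> bool) \<Rightarrow> ('k \<Rightarrow> 'k \<Rightarrow> bool) \<Rightarrow> ('k \<times> ctype) list \<Rightarrow> ('k \<Rightarrow> 'a set) \<Rightarrow> bool" where
  "slotting V E adj sl X \<longleftrightarrow> distinct (map fst sl) \<and> V = (\<Union>s\<in>set sl. X (fst s)) \<and>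
     (\<forall>s\<in>set sl. X (fst s) \<noteq> {} \<and> (snd s = One \<longleftrightarrow> card (X (fst s)) = 1) \<and>
        (\<forall>u\<in>X (fst s). \<forall>v\<in>X (fst s). u \<noteq> v \<longrightarrow> E u v = (snd s = Many True))) \<and>
     (\<forall>s\<in>set sl. \<forall>t\<in>set sl. fst s \<noteq> fst t \<longrightarrow> X (fst s) \<inter> X (fst t) = {} \<and>
        (\<forall>u\<in>X (fst s). \<forall>v\<in>X (fst t). E u v = adj (fst s) (fst t)))"

text \<open>Adjacency of a vertex chosen from slot \<^term>\<open>s\<close> to another vertex of slot \<^term>\<open>t\<close>, where \<^term>\<open>s = t\<close> is allowed.\<close>

fun nb :: "('k \<Rightarrow> 'k \<Rightarrow> bool) \<Rightarrow> 'k \<times> ctype \<Rightarrow> 'k \<times> ctype \<Rightarrow> bool" where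
  "nb adj (i, t) (j, t') = (if i = j then t = Many True else adj i j)"

text \<open>A co-resolving set contains at most one vertex of each slot. The search moves slots from the first list to
the chosen ones \<^term>\<open>S\<close> or the discarded ones \<^term>\<open>R\<close>; a chosen slot with several vertices still helps to tell
others apart.\<close>

fun has_co_resolving :: "('k \<Rightarrow> 'k \<Rightarrow> bool) \<Rightarrow> nat \<Rightarrow> ('k \<times> ctype) list \<Rightarrow> ('k \<times> ctype) list \<Rightarrow> ('k \<times> ctype) list \<Rightarrow> bool" where
  "has_co_resolving adj 0 sl S R =
     distinct (map (\<lambda>s. map (nb adj s) (R @ sl @ filter (\<lambda>s. snd s \<noteq> One) S)) S)"
| "has_co_resolving adj (Suc m) [] S R = False"
| "has_co_resolving adj (Suc m) (s # sl) S R =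
     (has_co_resolving adj m sl (s # S) R \<or> has_co_resolving adj (Suc m) sl S (s # R))"

definition slot_separated :: "('k \<Rightarrow> 'k \<Rightarrow> bool) \<Rightarrow> ('k \<times> ctype) set \<Rightarrow> ('k \<times> ctype) set \<Rightarrow> bool" where
  "slot_separated adj S R \<longleftrightarrow> (\<forall>s\<in>S. \<forall>t\<in>S. s \<noteq> t \<longrightarrow>
     (\<exists>r \<in> R \<union> {s \<in> S. snd s \<noteq> One}. nb adj s r \<noteq> nb adj t r))"

text \<open>The two disjuncts are the cases \<open>s \<in> T\<close> and
  \<open>s \<notin> T\<close>, matching the two branches of the search
  \<open>has_co_resolving\<close>.\<close>

lemma ex_subset_insert:
  assumes "s \<notin> A" "finite A"
  shows "(\<exists>T\<subseteq>insert s A. card T = Suc m \<and> P T) \<longleftrightarrow>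
    (\<exists>T\<subseteq>A. card T = m \<and> P (insert s T)) \<or> (\<exists>T\<subseteq>A. card T = Suc m \<and> P T)" (is "?l \<longleftrightarrow> ?r1 \<or> ?r2")
proof
  assume ?l
  then obtain T where T: "T \<subseteq> insert s A" "card T = Suc m" "P T"
    by blast
  show "?r1 \<or> ?r2"
  proof (cases "s \<in> T")
    case True
    then have "insert s (T - {s}) = T" "card (T - {s}) = m" "T - {s} \<subseteq> A"
      using T by auto
    then show ?thesis using T by metis
  next
    case False
    then have "T \<subseteq> A"
      using T by blast
    then show ?thesis using T by blast
  qed
next
  assume "?r1 \<or> ?r2"
  then show ?l
  proof
    assume ?r1
    then obtain T where T: "T \<subseteq> A" "card T = m" "P (insert s T)"
      by blast
    then have "card (insert s T) = Suc m"
      using assms finite_subset by (subst card_insert_disjoint) auto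
    moreover have "insert s T \<subseteq> insert s A"
      using T by blast
    ultimately show ?l
      using T by blast
  next
    assume ?r2
    then show ?l by (meson subset_insertI2)
  qed
qed

lemma has_co_resolving_iff:
  assumes "distinct (S @ sl @ R)"
  shows "has_co_resolving adj m sl S R \<longleftrightarrow>
    (\<exists>T\<subseteq>set sl. card T = m \<and> slot_separated adj (set S \<union> T) (set R \<union> (set sl - T)))"
  using assms
proof (induction adj m sl S R rule: has_co_resolving.induct)
  case (1 adj sl S R)
  have "(\<exists>T\<subseteq>set sl. card T = 0 \<and> slot_separated adj (set S \<union> T) (set R \<union> (set sl - T)))
     \<longleftrightarrow> slot_separated adj (set S) (set R \<union> set sl)"
  proof -
    have "T = {}" if "T \<subseteq> set sl" "card T = 0" for T
      using finite_subset[OF that(1)] that(2) by simp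
    moreover have "{} \<subseteq> set sl" "card ({} :: ('a \<times> ctype) set) = 0"
      by simp_all
    ultimately have "(\<exists>T\<subseteq>set sl. card T = 0 \<and> P T) \<longleftrightarrow> P {}" for P
      by metis
    then show ?thesis
      by simp
  qed
  \<comment> \<open>Two adjacency rows over the same list of witnesses differ iff some witness
    separates their slots, so distinctness of the rows is pairwise separation.\<close>
  also have "\<dots> \<longleftrightarrow> inj_on (\<lambda>s. map (nb adj s) (R @ sl @ filter (\<lambda>s. snd s \<noteq> One) S)) (set S)"
  proof -
    define W where "W = R @ sl @ filter (\<lambda>s. snd s \<noteq> One) S"
    define d where "d s t \<longleftrightarrow> (\<exists>r\<in>set W. nb adj s r \<noteq> nb adj t r)" for s t
    have "set W = set R \<union> set sl \<union> {s \<in> set S. snd s \<noteq> One}"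
      unfolding W_def by auto
    then have sep: "slot_separated adj (set S) (set R \<union> set sl) \<longleftrightarrow> (\<forall>s\<in>set S. \<forall>t\<in>set S. s \<noteq> t \<longrightarrow> d s t)"
      unfolding slot_separated_def d_def by simp
    have eq: "map (nb adj s) W = map (nb adj t) W \<longleftrightarrow> \<not> d s t" for s t
      unfolding map_eq_conv d_def by simp
    show ?thesis
      unfolding sep inj_on_def W_def[symmetric] eq by blast
  qed
  also have "\<dots> \<longleftrightarrow> has_co_resolving adj 0 sl S R"
    using 1 by (simp add: distinct_map)
  finally show ?case by simp
next
  case (2 adj m S R)
  then show ?case by auto
next
  case (3 adj m s sl S R)
  define P where "P T = slot_separated adj (set S \<union> T) (set R \<union> (set (s # sl) - T))" for T
  have s: "s \<notin> set sl"
    using 3 by simp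
  have "has_co_resolving adj m sl (s # S) R \<longleftrightarrow> (\<exists>T\<subseteq>set sl. card T = m \<and> P (insert s T))"
  proof -
    have "P (insert s T) = slot_separated adj (set (s # S) \<union> T) (set R \<union> (set sl - T))" for T
    proof -
      have "set (s # sl) - insert s T = set sl - T"
        using s by auto
      then show ?thesis
        unfolding P_def by simp
    qed
    then show ?thesis
      using 3 by simp
  qed
  moreover have "has_co_resolving adj (Suc m) sl S (s # R) \<longleftrightarrow> (\<exists>T\<subseteq>set sl. card T = Suc m \<and> P T)"
  proof -
    have "P T = slot_separated adj (set S \<union> T) (set (s # R) \<union> (set sl - T))" if "T \<subseteq> set sl" for T
    proof -
      have "set R \<union> (set (s # sl) - T) = set (s # R) \<union> (set sl - T)"
        using s that by auto
      then show ?thesis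
        unfolding P_def by simp
    qed
    moreover have "has_co_resolving adj (Suc m) sl S (s # R) \<longleftrightarrow>
        (\<exists>T\<subseteq>set sl. card T = Suc m \<and> slot_separated adj (set S \<union> T) (set (s # R) \<union> (set sl - T)))"
      using 3 by simp
    ultimately show ?thesis
      by metis
  qed
  moreover have "(\<exists>T\<subseteq>set (s # sl). card T = Suc m \<and> P T) \<longleftrightarrow>
      (\<exists>T\<subseteq>set sl. card T = m \<and> P (insert s T)) \<or> (\<exists>T\<subseteq>set sl. card T = Suc m \<and> P T)"
    unfolding list.set(2) by (rule ex_subset_insert[OF s finite_set])
  ultimately show ?case
    unfolding P_def has_co_resolving.simps by metis
qed

section \<open>Reading co-resolving sets off a slotting\<close>

context sgraph begin

lemma slotting_nb:
  assumes "slotting V E adj sl X" "s \<in> set sl" "t \<in> set sl" "u \<in> X (fst s)" "v \<in> X (fst t)" "u \<noteq> v"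
  shows "nb adj s t = E u v"
  using assms unfolding slotting_def by (cases s; cases t) auto

lemma slotting_fst_inj:
  assumes "slotting V E adj sl X" "s \<in> set sl" "t \<in> set sl" "fst s = fst t"
  shows "s = t"
  using assms unfolding slotting_def distinct_map inj_on_def by blast

lemma slotting_disjoint:
  assumes "slotting V E adj sl X" "s \<in> set sl" "t \<in> set sl" "u \<in> X (fst s)" "u \<in> X (fst t)"
  shows "s = t"
proof (rule ccontr)
  assume "s \<noteq> t"
  then have "fst s \<noteq> fst t"
    using slotting_fst_inj assms by metis
  then have "X (fst s) \<inter> X (fst t) = {}"
    using assms unfolding slotting_def by blast
  then show False
    using assms by blast
qed

lemma slotting_slot_of:
  assumes "slotting V E adj sl X" "u \<in> V"
  obtains s where "s \<in> set sl" "u \<in> X (fst s)"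
  using assms unfolding slotting_def by blast

lemma slotting_One_iff:
  assumes "slotting V E adj sl X" "s \<in> set sl"
  shows "snd s = One \<longleftrightarrow> card (X (fst s)) = 1" 
  using assms unfolding slotting_def by blast

lemma slotting_subset:
  assumes "slotting V E adj sl X" "s \<in> set sl"
  shows "X (fst s) \<subseteq> V" "X (fst s) \<noteq> {}" "finite (X (fst s))"
proof -
  show "X (fst s) \<subseteq> V" "X (fst s) \<noteq> {}"
    using assms unfolding slotting_def by blast+
  then show "finite (X (fst s))"
    using finite_V finite_subset by blast
qed

lemma slotting_other:
  assumes "slotting V E adj sl X" "s \<in> set sl" "snd s \<noteq> One"
  obtains w where "w \<in> X (fst s)" "w \<noteq> u"
proof -
  have "\<not> X (fst s) \<subseteq> {u}"
    using slotting_One_iff[OF assms(1,2)] slotting_subset[OF assms(1,2)] assms(3)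
    by (auto simp: subset_singleton_iff)
  then show ?thesis using that by blast
qed

lemma slotting_same_slot_twins:
  assumes "slotting V E adj sl X" "s \<in> set sl" "u \<in> X (fst s)" "v \<in> X (fst s)" "w \<noteq> u" "w \<noteq> v"
  shows "E u w = E v w"
proof (cases "w \<in> V")
  case True
  then obtain t where "t \<in> set sl" "w \<in> X (fst t)"
    using slotting_slot_of[OF assms(1)] by blast
  then show ?thesis
    using slotting_nb[OF assms(1,2)] assms by metis
next
  case False
  then show ?thesis
    using adj_in_V by blast
qed

text \<open>Two vertices of one slot agree on every third vertex, so a co-resolving set meets each
  slot at most once and determines a set of slots of the same size. Conversely, any choice of one
  representative per chosen slot works.\<close>

lemma slotting_co_resolving_iff:
  assumes sl: "slotting V E adj sl X"
  shows "(\<exists>S. co_resolving V E S \<and> card S = m) \<longleftrightarrow> has_co_resolving adj m sl [] []"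
proof -
  have dist: "distinct sl"
    using sl unfolding slotting_def distinct_map by blast
  have "(\<exists>S. co_resolving V E S \<and> card S = m) \<longleftrightarrow>
    (\<exists>T\<subseteq>set sl. card T = m \<and> slot_separated adj T (set sl - T))"
  proof
    assume "\<exists>S. co_resolving V E S \<and> card S = m"
    then obtain S where S: "S \<subseteq> V" "card S = m"
      and sep: "\<And>u v. u \<in> S \<Longrightarrow> v \<in> S \<Longrightarrow> u \<noteq> v \<Longrightarrow> \<exists>w\<in>V - S. E u w \<noteq> E v w"
      unfolding co_resolving_def by blast
    have "\<forall>u\<in>S. \<exists>s. s \<in> set sl \<and> u \<in> X (fst s)"
      using S slotting_slot_of[OF sl] by blast
    then obtain f where f: "\<And>u. u \<in> S \<Longrightarrow> f u \<in> set sl \<and> u \<in> X (fst (f u))"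
      by metis
    have inj: "inj_on f S"
    proof (rule inj_onI, rule ccontr)
      fix u v assume uv: "u \<in> S" "v \<in> S" "f u = f v" "u \<noteq> v"
      then obtain w where "w \<in> V - S" "E u w \<noteq> E v w"
        using sep by blast
      moreover have "f u \<in> set sl" "u \<in> X (fst (f u))" "v \<in> X (fst (f u))" "w \<noteq> u" "w \<noteq> v"
        using uv f[of u] f[of v] \<open>w \<in> V - S\<close> by auto
      ultimately show False
        using slotting_same_slot_twins[OF sl] by blast
    qed
    have "slot_separated adj (f ` S) (set sl - f ` S)"
      unfolding slot_separated_def
    proof (intro ballI impI)
      fix s t assume "s \<in> f ` S" "t \<in> f ` S" "s \<noteq> t"
      then obtain u v where uv: "u \<in> S" "v \<in> S" "s = f u" "t = f v" "u \<noteq> v"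
        by blast
      then obtain w where w: "w \<in> V - S" "E u w \<noteq> E v w"
        using sep by blast
      then obtain r where r: "r \<in> set sl" "w \<in> X (fst r)"
        using slotting_slot_of[OF sl] by blast
      \<comment> \<open>The witness \<open>w\<close> lies outside \<open>S\<close>. If its slot was
        chosen, that slot also holds a vertex of \<open>S\<close> and so has at least two
        vertices.\<close>
      have "snd r \<noteq> One" if "r \<in> f ` S"
      proof -
        obtain p where p: "p \<in> S" "r = f p"
          using \<open>r \<in> f ` S\<close> by blast
        then have "p \<noteq> w" "p \<in> X (fst r)"
          using w f by auto
        then show ?thesis
          using slotting_One_iff[OF sl r(1)] r(2) by (auto simp: card_1_singleton_iff)
      qed
      moreover have "nb adj s r \<noteq> nb adj t r"
      proof -
        have ne: "u \<noteq> w" "v \<noteq> w"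
          using uv w by blast+
        have "nb adj s r = E u w" "nb adj t r = E v w"
          using slotting_nb[OF sl _ r(1) _ r(2), of s u] slotting_nb[OF sl _ r(1) _ r(2), of t v]
            uv(3,4) f[OF uv(1)] f[OF uv(2)] ne by simp_all
        then show ?thesis
          using w by simp
      qed
      ultimately show "\<exists>r\<in>set sl - f ` S \<union> {s \<in> f ` S. snd s \<noteq> One}. nb adj s r \<noteq> nb adj t r"
        using r by blast
    qed
    moreover have "card (f ` S) = m" "f ` S \<subseteq> set sl"
      using inj S f by (auto simp: card_image)
    ultimately show "\<exists>T\<subseteq>set sl. card T = m \<and> slot_separated adj T (set sl - T)"
      by blast
  next
    assume "\<exists>T\<subseteq>set sl. card T = m \<and> slot_separated adj T (set sl - T)"
    then obtain T where T: "T \<subseteq> set sl" "card T = m" "slot_separated adj T (set sl - T)"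
      by blast
    have "\<forall>s\<in>set sl. \<exists>u. u \<in> X (fst s)"
      using slotting_subset(2)[OF sl] by blast
    then obtain r where r: "\<And>s. s \<in> set sl \<Longrightarrow> r s \<in> X (fst s)"
      by metis
    have inj: "inj_on r T"
    proof (rule inj_onI)
      fix s t assume st: "s \<in> T" "t \<in> T" "r s = r t"
      then have "s \<in> set sl" "t \<in> set sl"
        using T by blast+
      then show "s = t"
        using slotting_disjoint[OF sl, of s t "r s"] r[of s] r[of t] st(3) by simp
    qed
    have meets: "k = s" if "k \<in> set sl" "s \<in> T" "r s \<in> X (fst k)" for k s
      using that slotting_disjoint[OF sl, of k s "r s"] r[of s] T by blast
    have "co_resolving V E (r ` T)"
      unfolding co_resolving_def
    proof (intro conjI ballI impI)
      show "r ` T \<subseteq> V"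
        using r T slotting_subset(1)[OF sl] by blast
    next
      fix u v assume "u \<in> r ` T" "v \<in> r ` T" "u \<noteq> v"
      then obtain s t where st: "s \<in> T" "t \<in> T" "u = r s" "v = r t" "s \<noteq> t"
        by blast
      then obtain k where k: "k \<in> set sl - T \<union> {s \<in> T. snd s \<noteq> One}" "nb adj s k \<noteq> nb adj t k"
        using T(3) unfolding slot_separated_def by blast
      have k_sl: "k \<in> set sl"
        using k T by blast
      \<comment> \<open>The separating slot must offer a vertex that is not a chosen representative:
        any vertex if the slot was not chosen, a second one otherwise.\<close>
      have "\<exists>w \<in> X (fst k). w \<notin> r ` T"
      proof (cases "k \<in> T")
        case True
        then have "snd k \<noteq> One" using k by blast
        then obtain w where w: "w \<in> X (fst k)" "w \<noteq> r k"
          using slotting_other[OF sl k_sl] by blast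
        have "w \<notin> r ` T"
        proof
          assume "w \<in> r ` T"
          then obtain s where "s \<in> T" "w = r s"
            by blast
          then show False
            using meets[OF k_sl, of s] w by simp
        qed
        then show ?thesis
          using w by blast
      next
        case False
        have "r k \<notin> r ` T"
        proof
          assume "r k \<in> r ` T"
          then obtain s where "s \<in> T" "r k = r s"
            by blast
          then show False
            using meets[OF k_sl, of s] r[OF k_sl] False by simp
        qed
        then show ?thesis
          using r k_sl by blast
      qed
      then obtain w where w: "w \<in> X (fst k)" "w \<notin> r ` T"
        by blast
      have "E u w \<noteq> E v w"
      proof -
        have ne: "u \<noteq> w" "v \<noteq> w" "s \<in> set sl" "t \<in> set sl"
          using st w T(1) by blast+
        have "nb adj s k = E u w" "nb adj t k = E v w"
          using slotting_nb[OF sl _ k_sl _ w(1), of s u] slotting_nb[OF sl _ k_sl _ w(1), of t v]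
            st(3,4) r[of s] r[of t] ne by simp_all
        then show ?thesis
          using k(2) by simp
      qed
      then show "\<exists>w\<in>V - r ` T. E u w \<noteq> E v w"
        using w slotting_subset(1)[OF sl k_sl] by blast
    qed
    then show "\<exists>S. co_resolving V E S \<and> card S = m"
      using inj T card_image by blast
  qed
  then show ?thesis
    using has_co_resolving_iff[of "[]" sl "[]"] dist by simp
qed

lemma slotting_class_type:
  assumes sl: "slotting V E adj sl X" and s: "s \<in> set sl"
  shows "class_type E (X (fst s)) = snd s"
proof (cases "snd s")
  case One
  then show ?thesis
    using slotting_One_iff[OF sl s] unfolding class_type_def by simp
next
  case (Many b)
  obtain u where u: "u \<in> X (fst s)"
    using slotting_subset(2)[OF sl s] by blast
  obtain v where v: "v \<in> X (fst s)" "v \<noteq> u"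
    using slotting_other[OF sl s] Many by (metis ctype.distinct(1))
  have "E u v = b" if "u \<in> X (fst s)" "v \<in> X (fst s)" "u \<noteq> v" for u v
    using slotting_nb[OF sl s s that] Many by (cases s) auto
  then show ?thesis
    using u v slotting_One_iff[OF sl s] Many unfolding class_type_def by auto
qed

end

section \<open>Diameter test, merging of twin slots and comparison with a pattern\<close>

text \<open>Within one slot, distinct non-adjacent vertices occur only for type
  \<open>Many False\<close>; every other pair from equal keys is exempt.\<close>

definition diam_ok :: "('k \<Rightarrow> 'k \<Rightarrow> bool) \<Rightarrow> ('k \<times> ctype) list \<Rightarrow> bool" where
  "diam_ok adj sl \<longleftrightarrow> list_all (\<lambda>s. list_all (\<lambda>t.
     (fst s = fst t \<and> snd s \<noteq> Many False) \<or> nb adj s t \<or> list_ex (\<lambda>r. nb adj s r \<and> nb adj r t) sl) sl) sl"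

text \<open>A one-vertex slot has no inner adjacency, so it is compatible with either value.\<close>

fun compat :: "ctype \<Rightarrow> bool \<Rightarrow> bool" where
  "compat One b = True"
| "compat (Many c) b = (b = c)"

text \<open>This is the condition under which the union of two slots is again a slot: the adjacency
  between them must equal the one inside each, and they must agree on all other slots.\<close>

definition twin_slots :: "('k \<Rightarrow> 'k \<Rightarrow> bool) \<Rightarrow> ('k \<times> ctype) list \<Rightarrow> 'k \<times> ctype \<Rightarrow> 'k \<times> ctype \<Rightarrow> bool" where
  "twin_slots adj sl s t \<longleftrightarrow> compat (snd s) (adj (fst s) (fst t)) \<and> compat (snd t) (adj (fst s) (fst t)) \<and>
     list_all (\<lambda>r. fst r = fst s \<or> fst r = fst t \<or> adj (fst s) (fst r) = adj (fst t) (fst r)) sl"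

fun absorb :: "('k \<Rightarrow> 'k \<Rightarrow> bool) \<Rightarrow> ('k \<times> ctype) list \<Rightarrow> 'k \<times> ctype \<Rightarrow> ('k \<times> ctype) list \<Rightarrow> ('k \<times> ctype) list option" where
  "absorb adj sl s [] = None"
| "absorb adj sl s (t # ts) =
     (if twin_slots adj sl s t then Some ((fst t, Many (adj (fst s) (fst t))) # ts)
      else map_option ((#) t) (absorb adj sl s ts))"

text \<open>An absorbed slot disappears under the key of the absorbing one, so \<open>adj\<close> is
  never changed; this is sound because twin slots agree outside.\<close>

fun merge :: "('k \<Rightarrow> 'k \<Rightarrow> bool) \<Rightarrow> ('k \<times> ctype) list \<Rightarrow> ('k \<times> ctype) list \<Rightarrow> ('k \<times> ctype) list" where
  "merge adj acc [] = acc"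
| "merge adj acc (s # sl) = (case absorb adj (acc @ sl) s acc of
     None \<Rightarrow> merge adj (s # acc) sl | Some acc' \<Rightarrow> merge adj acc' sl)"

fun no_twins :: "('k \<Rightarrow> 'k \<Rightarrow> bool) \<Rightarrow> ('k \<times> ctype) list \<Rightarrow> ('k \<times> ctype) list \<Rightarrow> bool" where
  "no_twins adj ys [] = True"
| "no_twins adj ys (s # sl) = (list_all (\<lambda>t. \<not> twin_slots adj ys s t) sl \<and> no_twins adj ys sl)"

text \<open>Row \<^term>\<open>j\<close> of a pattern lists the adjacencies of its vertex \<^term>\<open>j\<close> to the earlier vertices, latest first; the
search extends the partial embedding \<^term>\<open>acc\<close> row by row, and \<^term>\<open>P\<close> holds the slots already tried for the
current row.\<close>

fun embeds :: "('k \<Rightarrow> 'k \<Rightarrow> bool) \<Rightarrow> (ctype list \<Rightarrow> bool) \<Rightarrow> ('k \<times> ctype) list \<Rightarrow> bool list list \<Rightarrow> ('k \<times> ctype) list \<Rightarrow> ('k \<times> ctype) list \<Rightarrow> bool" where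
  "embeds adj ok acc [] sl P = (sl = [] \<and> P = [] \<and> ok (rev (map snd acc)))"
| "embeds adj ok acc (r # rs) [] P = False"
| "embeds adj ok acc (r # rs) (s # sl) P =
    ((map (\<lambda>t. adj (fst s) (fst t)) acc = r \<and> embeds adj ok (s # acc) rs (P @ sl) []) \<or>
      embeds adj ok acc (r # rs) sl (s # P))"

lemma absorb_SomeD:
  assumes "absorb adj sl s ts = Some ts'"
  obtains us t vs where "ts = us @ t # vs" "ts' = us @ (fst t, Many (adj (fst s) (fst t))) # vs" "twin_slots adj sl s t"
proof -
  have "\<exists>us t vs. ts = us @ t # vs \<and> ts' = us @ (fst t, Many (adj (fst s) (fst t))) # vs \<and> twin_slots adj sl s t"
    using assms
  proof (induction ts arbitrary: ts')
    case (Cons t ts)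
    show ?case
    proof (cases "twin_slots adj sl s t")
      case True
      then have "t # ts = [] @ t # ts \<and> ts' = [] @ (fst t, Many (adj (fst s) (fst t))) # ts \<and> twin_slots adj sl s t"
        using Cons.prems by simp
      then show ?thesis by blast
    next
      case False
      then obtain ts'' where ts'': "absorb adj sl s ts = Some ts''" "ts' = t # ts''"
        using Cons.prems by auto
      from Cons.IH[OF ts''(1)] obtain us x vs where
        "ts = us @ x # vs \<and> ts'' = us @ (fst x, Many (adj (fst s) (fst x))) # vs \<and> twin_slots adj sl s x"
        by blast
      then have "t # ts = (t # us) @ x # vs \<and> ts' = (t # us) @ (fst x, Many (adj (fst s) (fst x))) # vs \<and> twin_slots adj sl s x"
        using ts'' by simp
      then show ?thesis by blast
    qed
  qed simp
  then show ?thesis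
    using that by blast
qed

text \<open>Each pair is tested in one order only and \<open>twin_slots\<close> need not be
  symmetric for an arbitrary \<open>adj\<close>, hence the disjunction.\<close>

lemma no_twinsD:
  assumes "no_twins adj ys sl" "s \<in> set sl" "t \<in> set sl" "s \<noteq> t"
  shows "\<not> twin_slots adj ys s t \<or> \<not> twin_slots adj ys t s"
  using assms by (induction sl) (auto simp: list_all_iff)

text \<open>\<open>ss\<close> is the order in which the remaining slots are matched to the remaining
  rows. Since \<open>acc\<close> holds the earlier choices latest first, it enters reversed in the
  type list, while the prefix of \<open>ss\<close> enters reversed in the rows.\<close>

lemma embedsD:
  assumes "embeds adj ok acc rs sl P"
  shows "\<exists>ss. set ss = set (sl @ P) \<and> (distinct (map fst (sl @ P)) \<longrightarrow> distinct (map fst ss)) \<and> length ss = length rs \<and> ok (rev (map snd acc) @ map snd ss) \<and>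
    (\<forall>j<length rs. rs ! j = map (\<lambda>t. adj (fst (ss ! j)) (fst t)) (rev (take j ss) @ acc))"
  using assms
proof (induction adj ok acc rs sl P rule: embeds.induct)
  case (1 adj ok acc sl P)
  then show ?case by auto
next
  case (2 adj ok acc r rs P)
  then show ?case by simp
next
  case (3 adj ok acc r rs s sl P)
  show ?case
  proof (cases "map (\<lambda>t. adj (fst s) (fst t)) acc = r \<and> embeds adj ok (s # acc) rs (P @ sl) []")
    case True
    then have "embeds adj ok (s # acc) rs (P @ sl) []"
      by blast
    from "3.IH"(1)[OF this] obtain ss where ss: "set ss = set ((P @ sl) @ [])"
      "distinct (map fst ((P @ sl) @ [])) \<longrightarrow> distinct (map fst ss)" "length ss = length rs"
      "ok (rev (map snd (s # acc)) @ map snd ss)"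
      "\<forall>j<length rs. rs ! j = map (\<lambda>t. adj (fst (ss ! j)) (fst t)) (rev (take j ss) @ s # acc)"
      by blast
    have "(r # rs) ! j = map (\<lambda>t. adj (fst ((s # ss) ! j)) (fst t)) (rev (take j (s # ss)) @ acc)"
      if "j < length (r # rs)" for j
      using ss(5) True that by (cases j) auto
    moreover have "set (s # ss) = set ((s # sl) @ P)" "length (s # ss) = length (r # rs)"
      "ok (rev (map snd acc) @ map snd (s # ss))"
      using ss(1,3,4) by auto
    moreover have "distinct (map fst (s # ss))" if "distinct (map fst ((s # sl) @ P))"
    proof -
      have "fst ` set ss = fst ` (set sl \<union> set P)"
        using ss(1) by (simp add: Un_commute)
      then show ?thesis
        using that ss(2) by (auto simp: image_Un)
    qed
    ultimately show ?thesis by blast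
  next
    case False
    then have "embeds adj ok acc (r # rs) sl (s # P)"
      using "3.prems" unfolding embeds.simps by blast
    from "3.IH"(2)[OF this] obtain ss where ss: "set ss = set (sl @ s # P)"
      "distinct (map fst (sl @ s # P)) \<longrightarrow> distinct (map fst ss)" "length ss = length (r # rs)"
      "ok (rev (map snd acc) @ map snd ss)"
      "\<forall>j<length (r # rs). (r # rs) ! j = map (\<lambda>t. adj (fst (ss ! j)) (fst t)) (rev (take j ss) @ acc)"
      by blast
    have "set ss = set ((s # sl) @ P)" "distinct (map fst ((s # sl) @ P)) \<longrightarrow> distinct (map fst ss)"
      using ss(1,2) by auto
    then show ?thesis
      using ss(3-5) by blast
  qed
qed

section \<open>Soundness of the computations on slots\<close>

context sgraph begin

lemma slotting_adj:
  assumes "slotting V E adj sl X" "s \<in> set sl" "t \<in> set sl" "fst s \<noteq> fst t" "u \<in> X (fst s)" "v \<in> X (fst t)"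
  shows "E u v = adj (fst s) (fst t)"
  using assms unfolding slotting_def by blast

lemma slotting_adj_sym:
  assumes "slotting V E adj sl X" "s \<in> set sl" "t \<in> set sl" "fst s \<noteq> fst t"
  shows "adj (fst s) (fst t) = adj (fst t) (fst s)"
proof -
  obtain u v where "u \<in> X (fst s)" "v \<in> X (fst t)"
    using slotting_subset(2) assms by blast
  then show ?thesis
    using slotting_adj[OF assms] slotting_adj[OF assms(1,3,2)] assms(4) adj_sym by metis
qed

lemma slotting_inner:
  assumes "slotting V E adj sl X" "s \<in> set sl" "u \<in> X (fst s)" "v \<in> X (fst s)" "u \<noteq> v"
  shows "snd s = Many (E u v)"
proof -
  have "E u v = (snd s = Many True)"
    using assms unfolding slotting_def by blast
  moreover have "snd s \<noteq> One"
    using slotting_One_iff[OF assms(1,2)] assms(3-5) by (auto simp: card_1_singleton_iff)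
  ultimately show ?thesis
    by (cases "snd s") auto
qed

lemma slotting_diam_ok:
  assumes sl: "slotting V E adj sl X"
    and diam: "\<And>u v. u \<in> V \<Longrightarrow> v \<in> V \<Longrightarrow> u \<noteq> v \<Longrightarrow> \<not> E u v \<Longrightarrow> \<exists>w. E u w \<and> E w v"
  shows "diam_ok adj sl"
proof -
  have "\<exists>r\<in>set sl. nb adj s r \<and> nb adj r t"
    if st: "s \<in> set sl" "t \<in> set sl" "\<not> nb adj s t" "\<not> (fst s = fst t \<and> snd s \<noteq> Many False)" for s t
  proof -
    obtain v where v: "v \<in> X (fst t)"
      using slotting_subset(2)[OF sl] st by blast
    \<comment> \<open>When \<open>s = t\<close> the only remaining type is
      \<open>Many False\<close>, which provides two distinct vertices.\<close>
    obtain u where u: "u \<in> X (fst s)" "u \<noteq> v"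
    proof (cases "s = t")
      case True
      then have "snd s \<noteq> One" using st by auto
      then show ?thesis using that slotting_other[OF sl st(1)] by blast
    next
      case False
      obtain u where "u \<in> X (fst s)"
        using slotting_subset(2)[OF sl] st by blast
      then show ?thesis
        using that False slotting_disjoint[OF sl st(1,2)] v by blast
    qed
    have "u \<in> V" "v \<in> V" "\<not> E u v"
      using u v st slotting_subset(1)[OF sl] slotting_nb[OF sl st(1,2) u(1) v u(2)] by blast+
    then obtain w where w: "E u w" "E w v"
      using diam u(2) by blast
    then have "w \<in> V" "w \<noteq> u" "w \<noteq> v"
      using adj_in_V adj_irrefl by blast+
    then obtain r where r: "r \<in> set sl" "w \<in> X (fst r)"
      using slotting_slot_of[OF sl] by blast
    have "nb adj s r" "nb adj r t"
      using slotting_nb[OF sl st(1) r(1) u(1) r(2)] slotting_nb[OF sl r(1) st(2) r(2) v] w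
        \<open>w \<noteq> u\<close> \<open>w \<noteq> v\<close> by simp_all
    then show ?thesis
      using r by blast
  qed
  then show ?thesis
    unfolding diam_ok_def list_all_iff list_ex_iff by blast
qed

text \<open>The list \<open>zs\<close> on which the twin test ran may lack \<open>s\<close> and
  \<open>t\<close>, since merging has already removed \<open>s\<close> from it. The value of
  \<open>X\<close> at \<open>fst s\<close> is left as it was: that key no longer occurs in
  \<open>sl'\<close>.\<close>

lemma slotting_merge_step:
  assumes sl: "slotting V E adj sl X" and st: "s \<in> set sl" "t \<in> set sl" "fst s \<noteq> fst t"
    and tw: "twin_slots adj zs s t" "set sl \<subseteq> set zs \<union> {s, t}"
    and sl': "distinct (map fst sl')" "set sl' = insert (fst t, Many (adj (fst s) (fst t))) (set sl - {s, t})"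
  shows "slotting V E adj sl' (X(fst t := X (fst s) \<union> X (fst t)))"
proof -
  define X' where "X' = X(fst t := X (fst s) \<union> X (fst t))"
  define n where "n = (fst t, Many (adj (fst s) (fst t)))"
  have X'_n: "X' (fst n) = X (fst s) \<union> X (fst t)"
    unfolding X'_def n_def by simp
  have old: "fst r \<noteq> fst s" "fst r \<noteq> fst t" "X' (fst r) = X (fst r)" if "r \<in> set sl" "r \<noteq> s" "r \<noteq> t" for r
  proof -
    show "fst r \<noteq> fst s" "fst r \<noteq> fst t"
      using that slotting_fst_inj[OF sl] st by blast+
    then show "X' (fst r) = X (fst r)"
      unfolding X'_def by simp
  qed
  have cases_sl': "r = n \<or> r \<in> set sl \<and> r \<noteq> s \<and> r \<noteq> t" if "r \<in> set sl'" for r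
    using that sl'(2) unfolding n_def by blast
  have twin_adj: "adj (fst s) (fst r) = adj (fst t) (fst r)" if r: "r \<in> set sl" "r \<noteq> s" "r \<noteq> t" for r
    using tw r old(1,2)[OF r] unfolding twin_slots_def list_all_iff by blast
  have compat: "compat (snd s) (adj (fst s) (fst t))" "compat (snd t) (adj (fst s) (fst t))"
    using tw unfolding twin_slots_def by blast+
  have inner: "E u v = adj (fst s) (fst t)" if uv: "u \<in> X' (fst n)" "v \<in> X' (fst n)" "u \<noteq> v" for u v
  proof -
    consider "u \<in> X (fst s)" "v \<in> X (fst s)" | "u \<in> X (fst t)" "v \<in> X (fst t)" | 
      "u \<in> X (fst s)" "v \<in> X (fst t)" | "u \<in> X (fst t)" "v \<in> X (fst s)"
      using uv X'_n by blast
    then show ?thesis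
    proof cases
      case 1
      then show ?thesis using slotting_inner[OF sl st(1) _ _ uv(3)] compat by simp
    next
      case 2
      then show ?thesis using slotting_inner[OF sl st(2) _ _ uv(3)] compat by simp
    next
      case 3
      then show ?thesis using slotting_adj[OF sl st] by simp
    next
      case 4
      then show ?thesis using slotting_adj[OF sl st, of v u] adj_sym[of u v] by simp
    qed
  qed
  have outer: "X' (fst n) \<inter> X' (fst r) = {} \<and> (\<forall>u\<in>X' (fst n). \<forall>v\<in>X' (fst r). E u v = adj (fst n) (fst r) \<and> E v u = adj (fst r) (fst n))"
    if r: "r \<in> set sl" "r \<noteq> s" "r \<noteq> t" for r
  proof (intro conjI ballI)
    show "X' (fst n) \<inter> X' (fst r) = {}"
    proof -
      have "X (fst s) \<inter> X (fst r) = {}" "X (fst t) \<inter> X (fst r) = {}"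
        using slotting_disjoint[OF sl st(1) r(1)] slotting_disjoint[OF sl st(2) r(1)] r(2,3) by blast+
      then show ?thesis
        unfolding old(3)[OF r] X'_n by blast
    qed
    fix u v assume uv: "u \<in> X' (fst n)" "v \<in> X' (fst r)"
    then have v: "v \<in> X (fst r)"
      using old(3)[OF r] by blast
    have "E u v = adj (fst t) (fst r)"
    proof (cases "u \<in> X (fst s)")
      case True
      then show ?thesis
        using slotting_adj[OF sl st(1) r(1) old(1)[OF r, symmetric] True v] twin_adj[OF r] by simp
    next
      case False
      then have "u \<in> X (fst t)" using uv X'_n by blast
      then show ?thesis
        using slotting_adj[OF sl st(2) r(1) old(2)[OF r, symmetric] _ v] by simp
    qed
    then show "E u v = adj (fst n) (fst r)" "E v u = adj (fst r) (fst n)"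
      using slotting_adj_sym[OF sl st(2) r(1) old(2)[OF r, symmetric]] adj_sym[of u v] unfolding n_def by simp_all
  qed
  have ne: "X (fst s) \<noteq> {}" "X (fst t) \<noteq> {}" "X (fst s) \<inter> X (fst t) = {}"
    using slotting_subset(2)[OF sl] st slotting_disjoint[OF sl st(1,2)] by blast+
  have card_n: "card (X' (fst n)) \<noteq> 1"
  proof
    assume "card (X' (fst n)) = 1"
    then obtain a where "X (fst s) \<union> X (fst t) = {a}"
      unfolding X'_n by (auto simp: card_1_singleton_iff)
    then have "X (fst s) = {a}" "X (fst t) = {a}"
      using ne(1,2) by (metis Un_upper1 subset_singletonD, metis Un_upper2 subset_singletonD)
    then show False
      using ne(3) by simp
  qed
  show ?thesis
    unfolding slotting_def X'_def[symmetric]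
  proof (intro conjI ballI)
    show "distinct (map fst sl')" by (rule sl')
    have "(\<Union>r\<in>set sl'. X' (fst r)) = X' (fst n) \<union> (\<Union>r\<in>set sl - {s, t}. X' (fst r))"
      using sl'(2) unfolding n_def by simp
    also have "\<dots> = X (fst s) \<union> X (fst t) \<union> (\<Union>r\<in>set sl - {s, t}. X (fst r))"
      using old(3) unfolding X'_n by simp
    also have "\<dots> = (\<Union>r\<in>set sl. X (fst r))"
      using st by blast
    finally show "V = (\<Union>r\<in>set sl'. X' (fst r))"
      using sl unfolding slotting_def by simp
  next
    fix r assume "r \<in> set sl'"
    then consider "r = n" | "r \<in> set sl" "r \<noteq> s" "r \<noteq> t"
      using cases_sl' by blast
    then have "X' (fst r) \<noteq> {} \<and> (snd r = One \<longleftrightarrow> card (X' (fst r)) = 1) \<and>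
      (\<forall>u\<in>X' (fst r). \<forall>v\<in>X' (fst r). u \<noteq> v \<longrightarrow> E u v = (snd r = Many True))"
    proof cases
      case 1
      then show ?thesis
        using ne X'_n card_n inner by (simp add: n_def)
    next
      case 2
      then show ?thesis
        using sl old(3)[OF 2] unfolding slotting_def by simp
    qed
    then show "X' (fst r) \<noteq> {}" "(snd r = One) = (card (X' (fst r)) = 1)"
      "\<And>u v. u \<in> X' (fst r) \<Longrightarrow> v \<in> X' (fst r) \<Longrightarrow> u \<noteq> v \<longrightarrow> E u v = (snd r = Many True)"
      by blast+
  next
    fix q r assume qr: "q \<in> set sl'" "r \<in> set sl'"
    show "fst q \<noteq> fst r \<longrightarrow> X' (fst q) \<inter> X' (fst r) = {} \<and>
        (\<forall>u\<in>X' (fst q). \<forall>v\<in>X' (fst r). E u v = adj (fst q) (fst r))"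
    proof -
      consider "q = n" "r = n" | "q = n" "r \<in> set sl" "r \<noteq> s" "r \<noteq> t" | "r = n" "q \<in> set sl" "q \<noteq> s" "q \<noteq> t"
        | "q \<in> set sl" "q \<noteq> s" "q \<noteq> t" "r \<in> set sl" "r \<noteq> s" "r \<noteq> t"
        using cases_sl'[OF qr(1)] cases_sl'[OF qr(2)] by blast
      then show ?thesis
      proof cases
        case 1
        then show ?thesis by simp
      next
        case 2
        then show ?thesis using outer by blast
      next
        case 3
        then show ?thesis using outer by blast
      next
        case 4
        then show ?thesis
          using sl old(3)[OF 4(1-3)] old(3)[OF 4(4-6)] unfolding slotting_def by simp
      qed
    qed
  qed
qed

lemma slotting_perm:
  assumes "slotting V E adj sl X" "set sl' = set sl" "distinct (map fst sl')"
  shows "slotting V E adj sl' X"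
  using assms unfolding slotting_def by simp

lemma slotting_merge:
  assumes "slotting V E adj (acc @ sl) X"
  shows "\<exists>X'. slotting V E adj (merge adj acc sl) X'"
  using assms
proof (induction sl arbitrary: acc X)
  case Nil
  then show ?case by auto
next
  case (Cons s sl)
  have dist: "distinct (map fst (acc @ s # sl))"
    using Cons.prems unfolding slotting_def by blast
  show ?case
  proof (cases "absorb adj (acc @ sl) s acc")
    case None
    have "slotting V E adj ((s # acc) @ sl) X"
      by (rule slotting_perm[OF Cons.prems]) (use dist in auto)
    then show ?thesis
      using Cons.IH None by simp
  next
    case (Some acc')
    then obtain us t vs where acc: "acc = us @ t # vs" "acc' = us @ (fst t, Many (adj (fst s) (fst t))) # vs"
      "twin_slots adj (acc @ sl) s t"
      by (rule absorb_SomeD)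
    have "slotting V E adj (acc' @ sl) (X(fst t := X (fst s) \<union> X (fst t)))"
      by (intro slotting_merge_step[OF Cons.prems _ _ _ acc(3)]) (use dist in \<open>auto simp: acc(1,2)\<close>)
    then show ?thesis
      using Cons.IH Some by simp
  qed
qed

text \<open>If a slot has a second vertex \<open>w\<close>, then \<open>E u w = E v w\<close>
  equates an adjacency inside the slot with one between the slots; this gives compatibility.
  Agreement on a third slot is tested at any of its vertices.\<close>

lemma slotting_twin_slots:
  assumes sl: "slotting V E adj sl X" and st: "s \<in> set sl" "t \<in> set sl" "s \<noteq> t"
    and uv: "u \<in> X (fst s)" "v \<in> X (fst t)" and twin: "twins E u v"
  shows "twin_slots adj sl s t"
proof -
  have ne: "fst s \<noteq> fst t"
    using slotting_fst_inj[OF sl] st by blast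
  have tw: "E u w = E v w" if "w \<noteq> u" "w \<noteq> v" for w
    using twin that unfolding twins_iff by blast
  have not_in: "u \<notin> X (fst t)" "v \<notin> X (fst s)"
    using slotting_disjoint[OF sl st(1,2)] st(3) uv by blast+
  have "compat (snd s) (adj (fst s) (fst t))"
  proof (cases "snd s = One")
    case False
    then obtain w where w: "w \<in> X (fst s)" "w \<noteq> u"
      using slotting_other[OF sl st(1)] by blast
    then have "E u w = E v w"
      using tw not_in by metis
    then show ?thesis
      using slotting_inner[OF sl st(1) uv(1) w(1)] w(2) slotting_adj[OF sl st(1,2) ne w(1) uv(2)] adj_sym[of v w]
      by simp
  qed simp
  moreover have "compat (snd t) (adj (fst s) (fst t))"
  proof (cases "snd t = One")
    case False
    then obtain w where w: "w \<in> X (fst t)" "w \<noteq> v"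
      using slotting_other[OF sl st(2)] by blast
    then have "E u w = E v w"
      using tw not_in by metis
    then show ?thesis
      using slotting_inner[OF sl st(2) uv(2) w(1)] w(2) slotting_adj[OF sl st(1,2) ne uv(1) w(1)]
      by simp
  qed simp
  moreover have "adj (fst s) (fst r) = adj (fst t) (fst r)"
    if r: "r \<in> set sl" "fst r \<noteq> fst s" "fst r \<noteq> fst t" for r
  proof -
    obtain w where w: "w \<in> X (fst r)"
      using slotting_subset(2)[OF sl r(1)] by blast
    then have "w \<noteq> u" "w \<noteq> v"
      using slotting_disjoint[OF sl r(1) st(1)] slotting_disjoint[OF sl r(1) st(2)] uv r by blast+
    then show ?thesis
      using tw slotting_adj[OF sl st(1) r(1) _ uv(1) w] slotting_adj[OF sl st(2) r(1) _ uv(2) w] r(2,3) by metis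
  qed
  ultimately show ?thesis
    unfolding twin_slots_def list_all_iff by blast
qed

text \<open>Vertices of one slot are always twins; twins from different slots would make the slots
  twin slots, in both orders because being twins is symmetric.\<close>

lemma slotting_twin_class:
  assumes sl: "slotting V E adj sl X" and nt: "no_twins adj sl sl" and s: "s \<in> set sl" and u: "u \<in> X (fst s)"
  shows "twin_class V E u = X (fst s)"
proof (intro equalityI subsetI)
  fix v assume v: "v \<in> twin_class V E u"
  then obtain t where t: "t \<in> set sl" "v \<in> X (fst t)"
    using slotting_slot_of[OF sl] unfolding twin_class_def by blast
  show "v \<in> X (fst s)"
  proof (rule ccontr)
    assume nv: "v \<notin> X (fst s)"
    then have "twins E u v" "twins E v u"
      using v u unfolding twin_class_def twins_iff by auto
    moreover have "s \<noteq> t"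
      using nv t by blast
    ultimately have "twin_slots adj sl s t" "twin_slots adj sl t s"
      using slotting_twin_slots[OF sl] s t u by metis+
    then show False
      using no_twinsD[OF nt s t(1) \<open>s \<noteq> t\<close>] by blast
  qed
next
  fix v assume v: "v \<in> X (fst s)"
  then have "v = u \<or> twins E v u"
    using slotting_same_slot_twins[OF sl s v u] unfolding twins_iff by auto
  then show "v \<in> twin_class V E u"
    using v slotting_subset(1)[OF sl s] unfolding twin_class_def by blast
qed

lemma slotting_twin_vertices:
  assumes sl: "slotting V E adj sl X" and nt: "no_twins adj sl sl"
  shows "twin_vertices V E = (\<lambda>s. X (fst s)) ` set sl"
proof (intro equalityI subsetI)
  fix M assume "M \<in> twin_vertices V E"
  then obtain u where "u \<in> V" "M = twin_class V E u"
    unfolding twin_vertices_def by blast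
  then show "M \<in> (\<lambda>s. X (fst s)) ` set sl"
    using slotting_slot_of[OF sl] slotting_twin_class[OF sl nt] by (metis imageI)
next
  fix M assume "M \<in> (\<lambda>s. X (fst s)) ` set sl"
  then obtain s where s: "s \<in> set sl" "M = X (fst s)"
    by blast
  then obtain u where "u \<in> X (fst s)"
    using slotting_subset(2)[OF sl] by blast
  then show "M \<in> twin_vertices V E"
    using slotting_twin_class[OF sl nt s(1)] slotting_subset(1)[OF sl s(1)] s(2)
    unfolding twin_vertices_def by blast
qed

end

section \<open>The ten structures\<close>

fun is1 :: "ctype \<Rightarrow> bool" where "is1 One = True" | "is1 (Many b) = False"
fun isK :: "ctype \<Rightarrow> bool" where "isK One = False" | "isK (Many b) = b"
fun isN :: "ctype \<Rightarrow> bool" where "isN One = False" | "isN (Many b) = (\<not> b)"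

text \<open>At most one of three vertices being of type (1K) means that some two are of type
  (N).\<close>

fun ok_G1 :: "ctype list \<Rightarrow> bool" where
  "ok_G1 [a, b, c] = ((isN a \<and> isN b) \<or> (isN a \<and> isN c) \<or> (isN b \<and> isN c))"
| "ok_G1 _ = False"

fun ok_G2 :: "ctype list \<Rightarrow> bool" where
  "ok_G2 [a, b, c] = ((isN b \<and> isK a) \<or> (isK a \<and> \<not> is1 c))"
| "ok_G2 _ = False"

fun ok_G3 :: "ctype list \<Rightarrow> bool" where
  "ok_G3 [a, b, c, d] = (isN a \<and> \<not> isN b \<and> \<not> isK d \<and> (\<not> isK b \<or> \<not> isN d \<and> \<not> isN c))"
| "ok_G3 _ = False"

fun ok_G4 :: "ctype list \<Rightarrow> bool" where
  "ok_G4 [a, b, c, d, e] = (is1 a \<and> is1 b \<and> is1 c \<and> is1 d \<and> is1 e)"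
| "ok_G4 _ = False"

fun ok_G5 :: "ctype list \<Rightarrow> bool" where
  "ok_G5 [a, b, c, d, e] = (is1 d \<and> is1 e \<and> \<not> isN a \<and> \<not> isN b \<and> \<not> isN c)"
| "ok_G5 _ = False"

text \<open>The three excluded pairs are the non-adjacent pairs of the pattern. Only the degree-4
  vertex \<open>a\<close> can be of type (N), and it is adjacent to all others; they then cannot be
  of type (K) and must be single vertices.\<close>

fun ok_G6 :: "ctype list \<Rightarrow> bool" where
  "ok_G6 [a, b, c, d, e] = (\<not> isN b \<and> \<not> isN c \<and> \<not> isN d \<and> \<not> isN e \<and>
     \<not> (isK b \<and> isK d) \<and> \<not> (isK b \<and> isK e) \<and> \<not> (isK c \<and> isK e) \<and>
     (\<not> isN a \<or> is1 b \<and> is1 c \<and> is1 d \<and> is1 e))"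
| "ok_G6 _ = False"

fun ok_G7 :: "ctype list \<Rightarrow> bool" where
  "ok_G7 [a, b, c, d, e] = (is1 e \<and> \<not> isN c \<and> \<not> isN d \<and> isK a \<and> is1 b)"
| "ok_G7 _ = False"

fun ok_G8 :: "ctype list \<Rightarrow> bool" where
  "ok_G8 [a, b, c, d] = (isK a \<and> is1 b \<and> isN c \<and> \<not> isN d)"
| "ok_G8 _ = False"

fun ok_G9 :: "ctype list \<Rightarrow> bool" where
  "ok_G9 [a, b, c, d] = (isK a \<and> isK b \<and> is1 c \<and> is1 d)"
| "ok_G9 _ = False"

fun ok_G10 :: "ctype list \<Rightarrow> bool" where
  "ok_G10 [a, b, c, d, e] = (isK a \<and> isK b \<and> \<not> isN e \<and> is1 c \<and> is1 d)"
| "ok_G10 _ = False"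

definition structures :: "(nat \<times> (nat \<times> nat) list \<times> (ctype list \<Rightarrow> bool)) list" where
  "structures = [(3, K3_es, ok_G1), (3, P3_es, ok_G2), (4, paw_es, ok_G3), (5, C5_es, ok_G4),
     (5, C5c_es, ok_G5), (5, C5cc_es, ok_G6), (5, kitep_es, ok_G7), (4, kite_es, ok_G8),
     (4, C4_es, ok_G9), (5, C4K1_es, ok_G10)]"

definition has_structure :: "'a set \<Rightarrow> ('a \<Rightarrow> 'a \<Rightarrow> bool) \<Rightarrow> nat \<times> (nat \<times> nat) list \<times> (ctype list \<Rightarrow> bool) \<Rightarrow> bool" where
  "has_structure V E = (\<lambda>(k, es, ok). \<exists>f. twin_iso V E k es f \<and> ok (map (\<lambda>i. class_type E (f i)) [0..<k]))"

definition pattern_rows :: "nat \<Rightarrow> (nat \<times> nat) list \<Rightarrow> bool list list" where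
  "pattern_rows k es = map (\<lambda>j. map (\<lambda>i. pat_adj es j i) (rev [0..<j])) [0..<k]"

definition matches :: "('k \<Rightarrow> 'k \<Rightarrow> bool) \<Rightarrow> ('k \<times> ctype) list \<Rightarrow> bool" where
  "matches adj sl \<longleftrightarrow>
     list_ex (\<lambda>(rows, ok). embeds adj ok [] rows sl []) (map (\<lambda>(k, es, ok). (pattern_rows k es, ok)) structures)"

\<comment> \<open>The rows of all patterns are computed once and stored as literal lists in the code
  equation of \<open>matches\<close>.\<close>
schematic_goal pattern_rows_structures:
  "map (\<lambda>(k, es, ok). (pattern_rows k es, ok)) structures = ?rows"
  by (simp add: structures_def pattern_rows_def pat_adj_def upt_rec K3_es_def P3_es_def paw_es_def C5_es_def
      C5c_es_def C5cc_es_def kitep_es_def kite_es_def C4_es_def C4K1_es_def)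

lemmas matches_code [code] = matches_def[unfolded pattern_rows_structures]

text \<open>The disjunctions replace implications because the rewriting of \<^verbatim>\<open>code_simp\<close> short-circuits only
conjunctions and disjunctions.\<close>

definition classified :: "('k \<Rightarrow> 'k \<Rightarrow> bool) \<Rightarrow> ('k \<times> ctype) list \<Rightarrow> bool" where
  "classified adj sl \<longleftrightarrow> \<not> diam_ok adj sl \<or> has_co_resolving adj 4 sl [] [] \<or>
     (let sl' = merge adj [] sl in no_twins adj sl' sl' \<and> matches adj sl')"

text \<open>This is the sufficiency half of the theorem: for each pattern all type assignments are
  enumerated, and the admissible ones have a co-resolving set with three elements and none with
  four.\<close>

lemma structures_check:
  "list_all (\<lambda>(k, es, ok). list_all (\<lambda>ts. \<not> ok ts \<or>
       has_co_resolving (pat_adj es) 3 (zip [0..<k] ts) [] [] \<and> \<not> has_co_resolving (pat_adj es) 4 (zip [0..<k] ts) [] [])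
     (List.n_lists k [One, Many True, Many False])) structures"
  by code_simp

lemma upt_numerals: "[0..<3] = [0, 1, 2]" "[0..<4] = [0, 1, 2, 3]" "[0..<5] = [0, 1, 2, 3, 4]"
  by (simp_all add: numeral_eq_Suc)

lemma all_less_5: "(\<forall>i<5. P i) \<longleftrightarrow> P 0 \<and> P 1 \<and> P 2 \<and> P 3 \<and> P (4 :: nat)"
proof -
  have "(\<forall>i<5. P i) \<longleftrightarrow> (\<forall>i\<in>set [0..<5]. P i)"
    by auto
  then show ?thesis
    unfolding upt_numerals by simp
qed

lemma not_isN_iff: "\<not> isN t \<longleftrightarrow> is1 t \<or> isK t"
  and not_isK_iff: "\<not> isK t \<longleftrightarrow> is1 t \<or> isN t"
  and not_is1_iff: "\<not> is1 t \<longleftrightarrow> isK t \<or> isN t"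
  by (cases t; simp)+

section \<open>Twin classes and their types\<close>

context sgraph begin

lemma twins_sym: "twins E u v \<Longrightarrow> twins E v u"
  unfolding twins_iff by auto

lemma twins_trans:
  assumes uv: "twins E u v" and vw: "twins E v w" and "u \<noteq> w"
  shows "twins E u w"
  unfolding twins_iff
proof (intro conjI allI impI)
  fix z assume z: "z \<noteq> u" "z \<noteq> w"
  show "E u z = E w z"
  proof (cases "z = v")
    case True
    \<comment> \<open>At the middle vertex neither hypothesis applies directly; the chain passes
      through the pair \<open>u\<close>, \<open>w\<close>, using that \<open>v\<close>,
      \<open>w\<close> agree on \<open>u\<close> and that \<open>u\<close>, \<open>v\<close> agree
      on \<open>w\<close>.\<close>
    have "E u v = E v u" "E v u = E w u" "E w u = E u w" "E u w = E v w" "E v w = E w v"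
      using uv vw \<open>u \<noteq> w\<close> adj_sym unfolding twins_iff by metis+
    then show ?thesis using True by simp
  next
    case False
    then show ?thesis using uv vw z unfolding twins_iff by metis
  qed
qed fact

lemma twin_class_eq:
  assumes "u \<in> twin_class V E v" "v \<in> V"
  shows "twin_class V E u = twin_class V E v"
proof -
  have "v \<in> V" "u \<in> V" "u = v \<or> twins E u v"
    using assms unfolding twin_class_def by blast+
  then show ?thesis
    unfolding twin_class_def using twins_sym twins_trans by blast
qed

lemma twin_vertices_cases:
  assumes "M \<in> twin_vertices V E" "u \<in> M"
  shows "u \<in> V" "M = twin_class V E u"
proof -
  obtain v where v: "v \<in> V" "M = twin_class V E v"
    using assms unfolding twin_vertices_def by blast
  then show "M = twin_class V E u"
    using twin_class_eq assms by simp
  show "u \<in> V"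
    using v assms unfolding twin_class_def by blast
qed

lemma twin_vertices_nonempty: "M \<in> twin_vertices V E \<Longrightarrow> M \<noteq> {}"
  unfolding twin_vertices_def twin_class_def by blast

lemma twin_vertices_finite: "M \<in> twin_vertices V E \<Longrightarrow> finite M"
  using twin_vertices_cases(1) finite_V finite_subset[of M V] by blast

lemma twin_vertices_same:
  assumes "M \<in> twin_vertices V E" "u \<in> M" "v \<in> M" "w \<noteq> u" "w \<noteq> v"
  shows "E u w = E v w"
proof (cases "u = v")
  case False
  then have "twins E u v"
    using assms(2) twin_vertices_cases(2)[OF assms(1,3)] unfolding twin_class_def by blast
  then show ?thesis
    using assms(4,5) unfolding twins_iff by blast
qed simp

text \<open>Any edge or non-edge inside a class can be moved to any other pair by replacing one
  endpoint at a time with a twin, so the class is complete or edgeless.\<close>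

lemma twin_vertices_inner:
  assumes M: "M \<in> twin_vertices V E" and uv: "u \<in> M" "v \<in> M" "u \<noteq> v"
  shows "class_type E M = Many (E u v)"
proof -
  have same: "E a b = E c d" if "a \<in> M" "b \<in> M" "c \<in> M" "d \<in> M" "a \<noteq> b" "c \<noteq> d" for a b c d
  proof (cases "a = d")
    case True
    then have "E a b = E c d"
      using twin_vertices_same[OF M that(2,3), of a] that adj_sym by metis
    then show ?thesis .
  next
    case False
    then have "E a b = E a d" "E a d = E c d"
      using twin_vertices_same[OF M that(2,4), of a] twin_vertices_same[OF M that(1,3), of d] that adj_sym by metis+
    then show ?thesis by simp
  qed
  then have "(\<forall>a\<in>M. \<forall>b\<in>M. a \<noteq> b \<longrightarrow> E a b) = E u v"
    using uv by blast
  moreover have "card M \<noteq> 1"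
    using uv by (auto simp: card_1_singleton_iff)
  ultimately show ?thesis
    unfolding class_type_def by simp
qed

lemma twin_vertices_card_ge_2:
  assumes "M \<in> twin_vertices V E"
  shows "card M \<ge> 2 \<longleftrightarrow> card M \<noteq> 1"
proof -
  have "card M \<noteq> 0"
    using twin_vertices_nonempty twin_vertices_finite assms by simp
  then show ?thesis by linarith
qed

text \<open>\<open>class_type\<close> uses \<open>Many False\<close> for "not complete"; for twin
  classes this is the same as edgeless.\<close>

lemma twin_vertices_types:
  assumes M: "M \<in> twin_vertices V E"
  shows "type1 M \<longleftrightarrow> is1 (class_type E M)" "typeK E M \<longleftrightarrow> isK (class_type E M)"
    "typeN E M \<longleftrightarrow> isN (class_type E M)"
proof -
  show "type1 M \<longleftrightarrow> is1 (class_type E M)" "typeK E M \<longleftrightarrow> isK (class_type E M)"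
    unfolding type1_def typeK_def class_type_def twin_vertices_card_ge_2[OF M] by auto
  show "typeN E M \<longleftrightarrow> isN (class_type E M)"
  proof (cases "card M = 1")
    case True
    then show ?thesis
      unfolding typeN_def class_type_def by simp
  next
    case False
    then obtain u v where uv: "u \<in> M" "v \<in> M" "u \<noteq> v"
      using twin_vertices_nonempty[OF M] by (metis card_1_singleton_iff is_singletonI' is_singleton_def One_nat_def)
    have "typeN E M \<longleftrightarrow> (\<forall>a\<in>M. \<forall>b\<in>M. \<not> E a b)"
      using False twin_vertices_card_ge_2[OF M] unfolding typeN_def by simp
    also have "\<dots> \<longleftrightarrow> \<not> E u v"
    proof
      assume n: "\<not> E u v"
      show "\<forall>a\<in>M. \<forall>b\<in>M. \<not> E a b"
      proof (intro ballI)
        fix a b assume ab: "a \<in> M" "b \<in> M"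
        show "\<not> E a b"
        proof (cases "a = b")
          case True
          then show ?thesis using adj_irrefl by simp
        next
          case False
          then show ?thesis
            using twin_vertices_inner[OF M uv] twin_vertices_inner[OF M ab] n by simp
        qed
      qed
    qed (use uv in blast)
    finally show ?thesis
      using twin_vertices_inner[OF M uv] by simp
  qed
qed

lemma twin_iso_types:
  assumes "twin_iso V E k es f" "i < k"
  shows "type1 (f i) \<longleftrightarrow> is1 (class_type E (f i))" "typeK E (f i) \<longleftrightarrow> isK (class_type E (f i))"
    "typeN E (f i) \<longleftrightarrow> isN (class_type E (f i))"
proof -
  have "f i \<in> twin_vertices V E"
    using assms unfolding twin_iso_def bij_betw_def by auto
  then show "type1 (f i) \<longleftrightarrow> is1 (class_type E (f i))" "typeK E (f i) \<longleftrightarrow> isK (class_type E (f i))"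
    "typeN E (f i) \<longleftrightarrow> isN (class_type E (f i))"
    by (rule twin_vertices_types)+
qed

lemma twin_iso_ex_cong:
  assumes "\<And>f. twin_iso V E k es f \<Longrightarrow> P f \<longleftrightarrow> Q f"
  shows "(\<exists>f. twin_iso V E k es f \<and> P f) \<longleftrightarrow> (\<exists>f. twin_iso V E k es f \<and> Q f)"
  using assms by blast

section \<open>The ten structures as conditions on type lists\<close>

lemmas type_simps = type1K_def type1N_def typeKN_def not_isN_iff not_isK_iff not_is1_iff upt_numerals

lemma struct_G1_iff: "struct_G1 V E \<longleftrightarrow> has_structure V E (3, K3_es, ok_G1)"
  unfolding struct_G1_def has_structure_def prod.case
proof (rule twin_iso_ex_cong)
  fix f assume iso: "twin_iso V E 3 K3_es f"
  define g where "g i = class_type E (f i)" for i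
  have "{i \<in> {0..<3}. type1K E (f i)} = {i \<in> {0..<3}. \<not> isN (g i)}"
    unfolding g_def type1K_def not_isN_iff using twin_iso_types[OF iso] by auto
  also have "\<dots> = set (filter (\<lambda>i. \<not> isN (g i)) [0, 1, 2])"
  proof -
    have "{0..<3} = set [0, 1, 2 :: nat]"
      unfolding upt_numerals(1)[symmetric] by (rule set_upt[symmetric])
    then show ?thesis
      unfolding set_filter by (rule arg_cong)
  qed
  also have "card \<dots> = length (filter (\<lambda>i. \<not> isN (g i)) [0, 1, 2])"
    by (intro distinct_card distinct_filter) simp
  finally have "card {i \<in> {0..<3}. type1K E (f i)} = length (filter (\<lambda>i. \<not> isN (g i)) [0, 1, 2])" .
  moreover have "length (filter (\<lambda>i. \<not> isN (g i)) [0, 1, 2]) \<le> 1 \<longleftrightarrow> ok_G1 [g 0, g 1, g 2]"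
    by simp
  ultimately show "card {i \<in> {0..<3}. type1K E (f i)} \<le> 1 \<longleftrightarrow> ok_G1 (map (\<lambda>i. class_type E (f i)) [0..<3])"
    unfolding g_def upt_numerals by simp
qed

lemma struct_G2_iff: "struct_G2 V E \<longleftrightarrow> has_structure V E (3, P3_es, ok_G2)"
  unfolding struct_G2_def has_structure_def prod.case
  by (rule twin_iso_ex_cong) (simp add: twin_iso_types type_simps)

lemma struct_G3_iff: "struct_G3 V E \<longleftrightarrow> has_structure V E (4, paw_es, ok_G3)"
  unfolding struct_G3_def has_structure_def prod.case
proof (rule twin_iso_ex_cong)
  fix f assume "twin_iso V E 4 paw_es f"
  then show "typeN E (f 0) \<and> type1K E (f 1) \<and> type1N E (f 3) \<and>
      (typeK E (f 0) \<or> typeK E (f 1) \<longrightarrow> \<not> typeN E (f 3) \<and> \<not> typeN E (f 2)) \<longleftrightarrow>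
    ok_G3 (map (\<lambda>i. class_type E (f i)) [0..<4])"
    by (cases "class_type E (f 0)"; cases "class_type E (f 1)"; cases "class_type E (f 2)"; cases "class_type E (f 3)")
      (auto simp: twin_iso_types type1K_def type1N_def upt_numerals)
qed

lemma struct_G4_iff: "struct_G4 V E \<longleftrightarrow> has_structure V E (5, C5_es, ok_G4)"
  unfolding struct_G4_def has_structure_def prod.case
  by (rule twin_iso_ex_cong) (simp add: twin_iso_types type_simps all_less_5)

lemma struct_G5_iff: "struct_G5 V E \<longleftrightarrow> has_structure V E (5, C5c_es, ok_G5)"
  unfolding struct_G5_def has_structure_def prod.case
  by (rule twin_iso_ex_cong) (simp add: twin_iso_types type_simps)

lemma struct_G6_iff: "struct_G6 V E \<longleftrightarrow> has_structure V E (5, C5cc_es, ok_G6)"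
  unfolding struct_G6_def has_structure_def prod.case
proof (rule twin_iso_ex_cong)
  fix f assume "twin_iso V E 5 C5cc_es f"
  then show "(\<forall>i\<in>{1, 2, 3, 4}. type1K E (f i)) \<and>
      (\<forall>i<5. \<forall>j<5. i \<noteq> j \<and> \<not> pat_adj C5cc_es i j \<longrightarrow> \<not> (typeK E (f i) \<and> typeK E (f j))) \<and>
      (\<forall>i<5. \<forall>j<5. pat_adj C5cc_es i j \<longrightarrow> \<not> (typeK E (f i) \<and> typeN E (f j))) \<longleftrightarrow>
    ok_G6 (map (\<lambda>i. class_type E (f i)) [0..<5])"
    unfolding all_less_5 pat_adj_def C5cc_es_def C5_es_def
    by (cases "class_type E (f 0)"; cases "class_type E (f 1)"; cases "class_type E (f 2)"; 
        cases "class_type E (f 3)"; cases "class_type E (f 4)")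
      (auto simp: twin_iso_types type1K_def upt_numerals)
qed

lemma struct_G7_iff: "struct_G7 V E \<longleftrightarrow> has_structure V E (5, kitep_es, ok_G7)"
  unfolding struct_G7_def has_structure_def prod.case
  by (rule twin_iso_ex_cong) (simp add: twin_iso_types type_simps)

lemma struct_G8_iff: "struct_G8 V E \<longleftrightarrow> has_structure V E (4, kite_es, ok_G8)"
  unfolding struct_G8_def has_structure_def prod.case
  by (rule twin_iso_ex_cong) (simp add: twin_iso_types type_simps)

lemma struct_G9_iff: "struct_G9 V E \<longleftrightarrow> has_structure V E (4, C4_es, ok_G9)"
  unfolding struct_G9_def has_structure_def prod.case
  by (rule twin_iso_ex_cong) (simp add: twin_iso_types type_simps)

lemma struct_G10_iff: "struct_G10 V E \<longleftrightarrow> has_structure V E (5, C4K1_es, ok_G10)"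
  unfolding struct_G10_def has_structure_def prod.case
  by (rule twin_iso_ex_cong) (simp add: twin_iso_types type_simps)

lemma structures_iff:
  "(\<exists>s\<in>set structures. has_structure V E s) \<longleftrightarrow>
    struct_G1 V E \<or> struct_G2 V E \<or> struct_G3 V E \<or> struct_G4 V E \<or> struct_G5 V E \<or>
    struct_G6 V E \<or> struct_G7 V E \<or> struct_G8 V E \<or> struct_G9 V E \<or> struct_G10 V E"
  unfolding structures_def struct_G1_iff struct_G2_iff struct_G3_iff struct_G4_iff struct_G5_iff
    struct_G6_iff struct_G7_iff struct_G8_iff struct_G9_iff struct_G10_iff by simp

text \<open>The twin partition is itself a slotting, with the vertices of the pattern as
  keys.\<close>

lemma twin_iso_slotting:
  assumes iso: "twin_iso V E k es f"
  shows "slotting V E (pat_adj es) (map (\<lambda>i. (i, class_type E (f i))) [0..<k]) f"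
proof -
  have bij: "bij_betw f {0..<k} (twin_vertices V E)"
    and adj: "\<And>i j. i < k \<Longrightarrow> j < k \<Longrightarrow> twin_adj E (f i) (f j) \<longleftrightarrow> pat_adj es i j"
    using iso unfolding twin_iso_def by blast+
  have cls: "f i \<in> twin_vertices V E" if "i < k" for i
    using bij that unfolding bij_betw_def by auto
  have ne: "f i \<noteq> f j" if "i < k" "j < k" "i \<noteq> j" for i j
    using bij that unfolding bij_betw_def inj_on_def by auto
  have union: "V = (\<Union>i\<in>{0..<k}. f i)"
  proof -
    have "V = \<Union> (twin_vertices V E)"
      unfolding twin_vertices_def twin_class_def by auto
    then show ?thesis
      using bij unfolding bij_betw_def by simp
  qed
  have disj: "f i \<inter> f j = {}" if "i < k" "j < k" "i \<noteq> j" for i j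
    using twin_vertices_cases(2)[OF cls[OF that(1)]] twin_vertices_cases(2)[OF cls[OF that(2)]] ne[OF that]
    by blast
  have cross: "E u v = pat_adj es i j" if ij: "i < k" "j < k" "i \<noteq> j" and uv: "u \<in> f i" "v \<in> f j" for i j u v
  proof -
    \<comment> \<open>One edge between two classes forces all of them: its endpoints are exchanged
      for twins one after the other.\<close>
    have "E u v" if "u' \<in> f i" "v' \<in> f j" "E u' v'" for u' v'
    proof -
      have "v' \<noteq> u" "v' \<noteq> u'" "u \<noteq> v" "u \<noteq> v'"
        using disj[OF ij] uv that by blast+
      then have "E u v'"
        using twin_vertices_same[OF cls[OF ij(1)] that(1) uv(1)] that(3) by metis
      then show ?thesis
        using twin_vertices_same[OF cls[OF ij(2)] that(2) uv(2) \<open>u \<noteq> v'\<close> \<open>u \<noteq> v\<close>] adj_sym by metis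
    qed
    then have "E u v \<longleftrightarrow> twin_adj E (f i) (f j)"
      unfolding twin_adj_def using ne[OF ij] uv by blast
    then show ?thesis
      using adj ij by simp
  qed
  have inner: "E u v = (class_type E (f i) = Many True)" if "i < k" "u \<in> f i" "v \<in> f i" "u \<noteq> v" for i u v
    using twin_vertices_inner[OF cls[OF that(1)] that(2-4)] by simp
  have type: "f i \<noteq> {} \<and> (class_type E (f i) = One \<longleftrightarrow> card (f i) = 1)" if "i < k" for i
    using twin_vertices_nonempty[OF cls[OF that]] unfolding class_type_def by simp
  show ?thesis
    unfolding slotting_def
  proof (intro conjI ballI)
    show "distinct (map fst (map (\<lambda>i. (i, class_type E (f i))) [0..<k]))"
      by (simp add: comp_def)
    show "V = (\<Union>s\<in>set (map (\<lambda>i. (i, class_type E (f i))) [0..<k]). f (fst s))"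
      using union by simp
  next
    fix s assume "s \<in> set (map (\<lambda>i. (i, class_type E (f i))) [0..<k])"
    then obtain i where i: "i < k" "s = (i, class_type E (f i))"
      by auto
    then show "f (fst s) \<noteq> {}" "snd s = One \<longleftrightarrow> card (f (fst s)) = 1"
      using type by simp_all
    fix u v assume "u \<in> f (fst s)" "v \<in> f (fst s)"
    then show "u \<noteq> v \<longrightarrow> E u v = (snd s = Many True)"
      using inner i by simp
  next
    fix s t assume "s \<in> set (map (\<lambda>i. (i, class_type E (f i))) [0..<k])" "t \<in> set (map (\<lambda>i. (i, class_type E (f i))) [0..<k])"
    then obtain i j where "i < k" "s = (i, class_type E (f i))" "j < k" "t = (j, class_type E (f j))"
      by auto
    then show "fst s \<noteq> fst t \<longrightarrow> f (fst s) \<inter> f (fst t) = {} \<and> (\<forall>u\<in>f (fst s). \<forall>v\<in>f (fst t). E u v = pat_adj es (fst s) (fst t))"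
      using disj cross by simp
  qed
qed

lemma has_structure_co_resolving:
  assumes "s \<in> set structures" "has_structure V E s"
  shows "(\<exists>S. co_resolving V E S \<and> card S = 3) \<and> \<not> (\<exists>S. co_resolving V E S \<and> card S = 4)"
proof -
  obtain k es ok where s: "s = (k, es, ok)"
    by (cases s)
  then obtain f where f: "twin_iso V E k es f" "ok (map (\<lambda>i. class_type E (f i)) [0..<k])"
    using assms unfolding has_structure_def by auto
  let ?ts = "map (\<lambda>i. class_type E (f i)) [0..<k]"
  have "t \<in> set [One, Many True, Many False]" for t
    by (cases t) auto
  then have "?ts \<in> set (List.n_lists k [One, Many True, Many False])"
    unfolding set_n_lists by auto
  then have "has_co_resolving (pat_adj es) 3 (zip [0..<k] ?ts) [] []"
    "\<not> has_co_resolving (pat_adj es) 4 (zip [0..<k] ?ts) [] []"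
    using structures_check assms(1) f(2) unfolding s list_all_iff by fastforce+
  moreover have "zip [0..<k] ?ts = map (\<lambda>i. (i, class_type E (f i))) [0..<k]"
    by (simp add: zip_map2 zip_same_conv_map)
  ultimately show ?thesis
    using slotting_co_resolving_iff[OF twin_iso_slotting[OF f(1)]] by simp
qed

text \<open>With no twin slots left, the slots are the vertices of the twin graph, and the order
  found by \<open>embeds\<close> is the isomorphism.\<close>

lemma matches_has_structure:
  assumes sl: "slotting V E adj sl X" and nt: "no_twins adj sl sl" and "matches adj sl"
  shows "\<exists>s\<in>set structures. has_structure V E s"
proof -
  obtain k es ok where st: "(k, es, ok) \<in> set structures" "embeds adj ok [] (pattern_rows k es) sl []"
    using assms(3) unfolding matches_def list_ex_iff by auto
  \<comment> \<open>The search never compares a slot with itself, whereas \<open>twin_iso\<close>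
    also speaks about \<open>i = j\<close>.\<close>
  have irrefl: "\<not> pat_adj es i i" for i
    using st(1) unfolding structures_def pat_adj_def
    by (auto simp: K3_es_def P3_es_def paw_es_def C5_es_def C5c_es_def C5cc_es_def kitep_es_def kite_es_def C4_es_def C4K1_es_def)
  have dist: "distinct (map fst sl)"
    using sl unfolding slotting_def by blast
  from embedsD[OF st(2)] obtain ss where ss: "set ss = set sl" "distinct (map fst ss)" "length ss = k" "ok (map snd ss)"
    and rows: "\<And>j. j < k \<Longrightarrow> pattern_rows k es ! j = map (\<lambda>t. adj (fst (ss ! j)) (fst t)) (rev (take j ss))"
    using dist by (auto simp: pattern_rows_def)
  define f where "f i = X (fst (ss ! i))" for i
  have slot: "ss ! i \<in> set sl" if "i < k" for i
    using ss(1,3) that nth_mem by blast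
  have key_ne: "fst (ss ! i) \<noteq> fst (ss ! j)" if "i < k" "j < k" "i \<noteq> j" for i j
    using ss(2,3) that nth_eq_iff_index_eq[OF ss(2), of i j] by simp
  have row: "adj (fst (ss ! j)) (fst (ss ! i)) = pat_adj es j i" if ij: "i < j" "j < k" for i j
  proof -
    have "take j ss = map ((!) ss) [0..<j]"
      using ij ss(3) by (intro nth_equalityI) auto
    moreover have "pattern_rows k es ! j = map (\<lambda>i. pat_adj es j i) (rev [0..<j])"
      using ij unfolding pattern_rows_def by simp
    ultimately have "map (\<lambda>i. pat_adj es j i) (rev [0..<j]) = map (\<lambda>i. adj (fst (ss ! j)) (fst (ss ! i))) (rev [0..<j])"
      using rows[OF ij(2)] by (simp add: rev_map comp_def)
    then show ?thesis
      unfolding map_eq_conv using ij by simp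
  qed
  have pat_sym: "pat_adj es i j = pat_adj es j i" for i j
    unfolding pat_adj_def by blast
  \<comment> \<open>The rows cover only pairs whose second index is smaller; the others follow from
    symmetry of both relations.\<close>
  have adj_pat: "adj (fst (ss ! i)) (fst (ss ! j)) = pat_adj es i j" if "i < k" "j < k" "i \<noteq> j" for i j
  proof (cases "i < j")
    case True
    then show ?thesis
      using slotting_adj_sym[OF sl slot[OF that(1)] slot[OF that(2)] key_ne[OF that]] row[of i j] that pat_sym by simp
  next
    case False
    then show ?thesis
      using row[of j i] that by simp
  qed
  have f_ne: "f i \<inter> f j = {}" "f i \<noteq> {}" if "i < k" "j < k" "i \<noteq> j" for i j
  proof -
    have "ss ! i \<noteq> ss ! j"
      using key_ne[OF that] by auto
    then show "f i \<inter> f j = {}"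
      unfolding f_def using slotting_disjoint[OF sl slot[OF that(1)] slot[OF that(2)]] by blast
    show "f i \<noteq> {}"
      unfolding f_def using slotting_subset(2)[OF sl slot[OF that(1)]] .
  qed
  have "twin_iso V E k es f"
    unfolding twin_iso_def
  proof (intro conjI allI impI)
    have "f ` {0..<k} = (\<lambda>s. X (fst s)) ` set ss"
    proof -
      have "set ss = (!) ss ` {0..<k}"
        using ss(3) by (metis map_nth set_map set_upt)
      then show ?thesis
        unfolding f_def by (simp add: image_image)
    qed
    then have "f ` {0..<k} = twin_vertices V E"
      using slotting_twin_vertices[OF sl nt] ss(1) by simp
    moreover have "inj_on f {0..<k}"
      using f_ne unfolding inj_on_def by (metis Int_absorb atLeastLessThan_iff)
    ultimately show "bij_betw f {0..<k} (twin_vertices V E)"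
      unfolding bij_betw_def by blast
  next
    fix i j assume ij: "i < k" "j < k"
    show "twin_adj E (f i) (f j) = pat_adj es i j"
    proof (cases "i = j")
      case True
      then show ?thesis
        using irrefl unfolding twin_adj_def by simp
    next
      case False
      have "E u v = pat_adj es i j" if "u \<in> f i" "v \<in> f j" for u v
        using slotting_adj[OF sl slot[OF ij(1)] slot[OF ij(2)] key_ne[OF ij False]] that adj_pat[OF ij False]
        unfolding f_def by simp
      moreover have "f i \<noteq> f j" "f i \<noteq> {}" "f j \<noteq> {}"
        using f_ne(1)[OF ij False] f_ne(2)[OF ij False] f_ne(2)[OF ij(2,1)] False by auto
      ultimately show ?thesis
        unfolding twin_adj_def by blast
    qed
  qed
  moreover have "map (\<lambda>i. class_type E (f i)) [0..<k] = map snd ss"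
    using slotting_class_type[OF sl slot] ss(3) unfolding f_def by (intro nth_equalityI) auto
  ultimately have "has_structure V E (k, es, ok)"
    unfolding has_structure_def using ss(4) by auto
  then show ?thesis
    using st(1) by blast
qed

lemma classified_has_structure:
  assumes sl: "slotting V E adj sl X" and "classified adj sl"
    and diam: "\<And>u v. u \<in> V \<Longrightarrow> v \<in> V \<Longrightarrow> u \<noteq> v \<Longrightarrow> \<not> E u v \<Longrightarrow> \<exists>w. E u w \<and> E w v"
    and no4: "\<not> (\<exists>S. co_resolving V E S \<and> card S = 4)"
  shows "\<exists>s\<in>set structures. has_structure V E s"
proof -
  have "diam_ok adj sl"
    using slotting_diam_ok[OF sl diam] .
  moreover have "\<not> has_co_resolving adj 4 sl [] []"
    using slotting_co_resolving_iff[OF sl] no4 by blast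
  ultimately have "no_twins adj (merge adj [] sl) (merge adj [] sl)" "matches adj (merge adj [] sl)"
    using assms(2) unfolding classified_def Let_def by blast+
  moreover obtain X' where "slotting V E adj (merge adj [] sl) X'"
    using slotting_merge[of adj "[]" sl X] sl by auto
  ultimately show ?thesis
    using matches_has_structure by blast
qed

end

section \<open>Adjacency to two probing vertices\<close>

text \<open>\<open>KX\<close> and \<open>KY\<close> stand for the probing vertices and \<open>KA\<close>, \<open>KB\<close>, \<open>KC\<close> for the three cells; the
Boolean arguments record how a cell is split by its adjacency to the one-element cells among the others.
In \<open>key_adj\<close> the pairs \<^term>\<open>p\<close>, \<^term>\<open>q\<close>, \<^term>\<open>r\<close> are the adjacencies of the three cells to the probing vertices.\<close>

datatype key = KX | KY | KA bool bool | KB | KC bool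

fun key_adj :: "bool \<Rightarrow> bool \<times> bool \<Rightarrow> bool \<times> bool \<Rightarrow> bool \<times> bool \<Rightarrow> (bool \<Rightarrow> bool) \<Rightarrow> (bool \<Rightarrow> bool) \<Rightarrow>
    (bool \<Rightarrow> bool) \<Rightarrow> bool \<Rightarrow> bool \<Rightarrow> key \<Rightarrow> key \<Rightarrow> bool" where
  "key_adj xy p q r ab ac bc ka kc KX KX = False"
| "key_adj xy p q r ab ac bc ka kc KX KY = xy"
| "key_adj xy p q r ab ac bc ka kc KX (KA _ _) = fst p"
| "key_adj xy p q r ab ac bc ka kc KX KB = fst q"
| "key_adj xy p q r ab ac bc ka kc KX (KC _) = fst r"
| "key_adj xy p q r ab ac bc ka kc KY KX = xy"
| "key_adj xy p q r ab ac bc ka kc KY KY = False"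
| "key_adj xy p q r ab ac bc ka kc KY (KA _ _) = snd p"
| "key_adj xy p q r ab ac bc ka kc KY KB = snd q"
| "key_adj xy p q r ab ac bc ka kc KY (KC _) = snd r"
| "key_adj xy p q r ab ac bc ka kc (KA _ _) KX = fst p"
| "key_adj xy p q r ab ac bc ka kc (KA _ _) KY = snd p"
| "key_adj xy p q r ab ac bc ka kc (KA _ _) (KA _ _) = ka"
| "key_adj xy p q r ab ac bc ka kc (KA s _) KB = ab s"
| "key_adj xy p q r ab ac bc ka kc (KA _ t) (KC _) = ac t"
| "key_adj xy p q r ab ac bc ka kc KB KX = fst q"
| "key_adj xy p q r ab ac bc ka kc KB KY = snd q"
| "key_adj xy p q r ab ac bc ka kc KB (KA s _) = ab s"
| "key_adj xy p q r ab ac bc ka kc KB KB = False"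
| "key_adj xy p q r ab ac bc ka kc KB (KC s) = bc s"
| "key_adj xy p q r ab ac bc ka kc (KC _) KX = fst r"
| "key_adj xy p q r ab ac bc ka kc (KC _) KY = snd r"
| "key_adj xy p q r ab ac bc ka kc (KC _) (KA _ t) = ac t"
| "key_adj xy p q r ab ac bc ka kc (KC s) KB = bc s"
| "key_adj xy p q r ab ac bc ka kc (KC _) (KC _) = kc"

fun slot :: "'k \<times> bool \<times> ctype option \<Rightarrow> ('k \<times> ctype) list" where
  "slot (i, k, None) = []"
| "slot (i, k, Some One) = [(i, One)]"
| "slot (i, k, Some (Many _)) = [(i, Many k)]"

text \<open>In a size, \<^term>\<open>Many True\<close> only means at least two vertices: \<open>slot\<close> replaces its argument by the adjacency
inside the cell.\<close>

definition slot_size :: "'a set \<Rightarrow> ctype option" where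
  "slot_size M = (if M = {} then None else if card M = 1 then Some One else Some (Many True))"

definition key_slots :: "bool \<Rightarrow> bool \<Rightarrow> bool \<Rightarrow> ctype option list \<Rightarrow> (key \<times> ctype) list" where
  "key_slots ka kb kc ss = concat (map slot (zip
     [KX, KY, KA False False, KA False True, KA True False, KA True True, KB, KC False, KC True]
     (zip [False, False, ka, ka, ka, ka, kb, kc, kc] (Some One # Some One # ss))))"

section \<open>The finite families of candidates\<close>

text \<open>A linear order on traces; requiring it of two cells with interchangeable roles leaves
  one labelling of each candidate.\<close>

definition lex_less :: "bool \<times> bool \<Rightarrow> bool \<times> bool \<Rightarrow> bool" where
  "lex_less p q \<longleftrightarrow> (\<not> fst p \<and> fst q) \<or> (fst p = fst q \<and> \<not> snd p \<and> snd q)"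

lemma lex_less_linear: "p \<noteq> q \<Longrightarrow> lex_less p q \<or> lex_less q p"
  unfolding lex_less_def by (cases p; cases q) auto

definition bools :: "bool list" where "bools = [False, True]"

definition sizes :: "ctype option list" where "sizes = [None, Some One, Some (Many True)]"

text \<open>Possible sizes of the two parts of a cell with at least two vertices; the removed pairs
  have total size 0 or 1.\<close>

definition split_sizes :: "(ctype option \<times> ctype option) list" where
  "split_sizes = filter (\<lambda>s. s \<notin> {(None, None), (Some One, None), (None, Some One)}) (List.product sizes sizes)"

definition trace_triples :: "((bool \<times> bool) \<times> (bool \<times> bool) \<times> bool \<times> bool) list" where
  "trace_triples = (let tr = List.product bools bools in
     filter (\<lambda>(p, q, r). p \<noteq> q \<and> p \<noteq> r \<and> q \<noteq> r) (List.product tr (List.product tr tr)))"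

text \<open>Without one-element cells nothing is split, so each adjacency between cells is a single
  Boolean.\<close>

definition check_no_singleton :: "bool \<Rightarrow> bool" where
  "check_no_singleton xy \<longleftrightarrow> list_all (\<lambda>(p, q, r). \<not> lex_less q r \<or>
     list_all (\<lambda>ab. list_all (\<lambda>ac. list_all (\<lambda>bc. list_all (\<lambda>ka. list_all (\<lambda>kb. list_all (\<lambda>kc.
       classified (key_adj xy p q r (\<lambda>_. ab) (\<lambda>_. ac) (\<lambda>_. bc) ka kc)
         (key_slots ka kb kc [Some (Many True), None, None, None, Some (Many True), Some (Many True), None]))
     bools) bools) bools) bools) bools) bools) trace_triples"

text \<open>\<open>KB\<close> is the one-element cell. The flag of a part of the other two cells is
  its adjacency to that vertex, so \<open>ab\<close> and \<open>bc\<close> are the identity.\<close>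

definition check_one_singleton :: "bool \<Rightarrow> bool" where
  "check_one_singleton xy \<longleftrightarrow> list_all (\<lambda>(p, q, r). \<not> lex_less p r \<or>
     list_all (\<lambda>ac. list_all (\<lambda>ka. list_all (\<lambda>kc. list_all (\<lambda>(s0, s2). list_all (\<lambda>(s5, s6).
       classified (key_adj xy p q r (\<lambda>s. s) (\<lambda>_. ac) (\<lambda>s. s) ka kc)
         (key_slots ka False kc [s0, None, s2, None, Some One, s5, s6]))
     split_sizes) split_sizes) bools) bools) bools) trace_triples"

text \<open>\<open>KB\<close> and \<open>KC\<close> are one-element cells and split
  \<open>KA\<close> into up to four parts. The third cell is only required to be nonempty, so three
  one-element cells are included. The inner adjacencies of \<open>KB\<close> and \<open>KC\<close>
  are set to \<open>False\<close>, there being no pairs inside.\<close>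

definition check_two_singletons :: "bool \<Rightarrow> bool" where
  "check_two_singletons xy \<longleftrightarrow> list_all (\<lambda>(p, q, r). \<not> lex_less q r \<or>
     list_all (\<lambda>bc. list_all (\<lambda>ka. list_all (\<lambda>s0. list_all (\<lambda>s1. list_all (\<lambda>s2. list_all (\<lambda>s3.
       (s0 = None \<and> s1 = None \<and> s2 = None \<and> s3 = None) \<or>
       classified (key_adj xy p q r (\<lambda>s. s) (\<lambda>s. s) (\<lambda>_. bc) ka False)
         (key_slots ka False False [s0, s1, s2, s3, Some One, Some One, None]))
     sizes) sizes) sizes) sizes) bools) bools) trace_triples"

lemma no_singleton_checked_False: "check_no_singleton False"
  by code_simp

lemma no_singleton_checked_True: "check_no_singleton True"
  by code_simp

lemma one_singleton_checked_False: "check_one_singleton False"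
  by code_simp

lemma one_singleton_checked_True: "check_one_singleton True"
  by code_simp

lemma two_singletons_checked_False: "check_two_singletons False"
  by code_simp

lemma two_singletons_checked_True: "check_two_singletons True"
  by code_simp


lemma set_bools: "b \<in> set bools"
  unfolding bools_def by simp

lemma set_trace_triples: "(p, q, r) \<in> set trace_triples \<longleftrightarrow> p \<noteq> q \<and> p \<noteq> r \<and> q \<noteq> r"
  unfolding trace_triples_def Let_def using set_bools by (cases p; cases q; cases r) auto

lemma slot_size_in_sizes: "slot_size M \<in> set sizes"
  unfolding slot_size_def sizes_def by simp

lemma slot_size_split:
  assumes "finite (M \<union> N)" "M \<inter> N = {}" "M \<union> N \<noteq> {}" "card (M \<union> N) \<noteq> 1"
  shows "(slot_size M, slot_size N) \<in> set split_sizes"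
proof -
  have "(slot_size M, slot_size N) \<notin> {(None, None), (Some One, None), (None, Some One)}"
    using assms unfolding slot_size_def by (auto split: if_splits)
  then show ?thesis
    unfolding split_sizes_def using slot_size_in_sizes[of M] slot_size_in_sizes[of N] by simp
qed

lemma set_slot_slot_size:
  "s \<in> set (slot (i, k, slot_size M)) \<longleftrightarrow> M \<noteq> {} \<and> s = (i, if card M = 1 then One else Many k)"
  unfolding slot_size_def by auto

lemma map_fst_slot: "map fst (slot (i, k, z)) = (if z = None then [] else [i])"
  by (cases "(i, k, z)" rule: slot.cases) auto

lemma distinct_map_fst_slots:
  "distinct (map fst zs) \<Longrightarrow> distinct (map fst (concat (map slot zs)))"
proof (induction zs)
  case (Cons z zs)
  obtain i k n where z: "z = (i, k, n)"
    by (cases z)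
  have "fst ` set (slot y) \<subseteq> {fst y}" for y :: "'a \<times> bool \<times> ctype option"
    using map_fst_slot[of "fst y" "fst (snd y)" "snd (snd y)"] by (metis empty_subsetI list.set_map list.simps(15) 
        list.set(1) prod.collapse subset_refl)
  then have "(\<Union>y\<in>set zs. fst ` set (slot y)) \<subseteq> (\<Union>y\<in>set zs. {fst y})"
    by (intro UN_mono subset_refl)
  then have "fst ` set (concat (map slot zs)) \<subseteq> fst ` set zs"
    by (simp add: image_UN UNION_singleton_eq_range)
  then show ?case
    using Cons map_fst_slot[of i k n] unfolding z by auto
qed simp

context sgraph begin

text \<open>Keys may carry empty sets here: \<open>slot\<close> drops them, so one fixed list of
  keys serves all ways of splitting.\<close>

lemma slotting_slots:
  assumes dist: "distinct (map fst zs)"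
    and zs: "\<And>i k z. (i, k, z) \<in> set zs \<Longrightarrow> z = slot_size (X i)"
    and inner: "\<And>i k z u v. (i, k, z) \<in> set zs \<Longrightarrow> u \<in> X i \<Longrightarrow> v \<in> X i \<Longrightarrow> u \<noteq> v \<Longrightarrow> E u v = k"
    and union: "V = (\<Union>i\<in>fst ` set zs. X i)"
    and disj: "\<And>i j. i \<noteq> j \<Longrightarrow> X i \<inter> X j = {}"
    and cross: "\<And>i j u v. i \<noteq> j \<Longrightarrow> u \<in> X i \<Longrightarrow> v \<in> X j \<Longrightarrow> E u v = adj i j"
  shows "slotting V E adj (concat (map slot zs)) X"
proof -
  have slotD: "\<exists>k. (fst s, k, slot_size (X (fst s))) \<in> set zs \<and> X (fst s) \<noteq> {} \<and> snd s = (if card (X (fst s)) = 1 then One else Many k)"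
    if s: "s \<in> set (concat (map slot zs))" for s
  proof -
    obtain i k z where z: "(i, k, z) \<in> set zs" "s \<in> set (slot (i, k, z))"
      using s by auto
    then have "z = slot_size (X i)"
      using zs by blast
    then show ?thesis
      using z set_slot_slot_size[of s i k "X i"] by auto
  qed
  show ?thesis
    unfolding slotting_def
  proof (intro conjI ballI)
    show "distinct (map fst (concat (map slot zs)))"
      by (rule distinct_map_fst_slots[OF dist])
    show "V = (\<Union>s\<in>set (concat (map slot zs)). X (fst s))"
    proof (intro equalityI subsetI)
      fix u assume "u \<in> V"
      then obtain i k z where z: "(i, k, z) \<in> set zs" "u \<in> X i"
        using union by auto
      then have "(i, if card (X i) = 1 then One else Many k) \<in> set (slot (i, k, z))"
        using zs[OF z(1)] set_slot_slot_size by fast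
      then show "u \<in> (\<Union>s\<in>set (concat (map slot zs)). X (fst s))"
        using z by force
    next
      fix u assume "u \<in> (\<Union>s\<in>set (concat (map slot zs)). X (fst s))"
      then obtain s where "s \<in> set (concat (map slot zs))" "u \<in> X (fst s)"
        by blast
      then show "u \<in> V"
        using slotD[of s] union by force
    qed
  next
    fix s assume "s \<in> set (concat (map slot zs))"
    from slotD[OF this] obtain k where k: "(fst s, k, slot_size (X (fst s))) \<in> set zs" "X (fst s) \<noteq> {}"
      "snd s = (if card (X (fst s)) = 1 then One else Many k)"
      by blast
    then show "X (fst s) \<noteq> {}" "snd s = One \<longleftrightarrow> card (X (fst s)) = 1"
      by auto
    fix u v assume uv: "u \<in> X (fst s)" "v \<in> X (fst s)"
    show "u \<noteq> v \<longrightarrow> E u v = (snd s = Many True)"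
    proof
      assume "u \<noteq> v"
      then have "card (X (fst s)) \<noteq> 1"
        using uv by (auto simp: card_1_singleton_iff)
      then show "E u v = (snd s = Many True)"
        using inner[OF k(1) uv \<open>u \<noteq> v\<close>] k(3) by simp
    qed
  next
    fix s t
    show "fst s \<noteq> fst t \<longrightarrow> X (fst s) \<inter> X (fst t) = {} \<and> (\<forall>u\<in>X (fst s). \<forall>v\<in>X (fst t). E u v = adj (fst s) (fst t))"
      using disj cross by blast
  qed
qed

end

lemma classified_no_singleton:
  assumes "p \<noteq> q" "p \<noteq> r" "q \<noteq> r" "lex_less q r"
  shows "classified (key_adj xy p q r (\<lambda>_. ab) (\<lambda>_. ac) (\<lambda>_. bc) ka kc)
    (key_slots ka kb kc [Some (Many True), None, None, None, Some (Many True), Some (Many True), None])"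
proof -
  have "check_no_singleton xy"
    using no_singleton_checked_False no_singleton_checked_True by (cases xy) simp_all
  moreover have "(p, q, r) \<in> set trace_triples"
    using assms set_trace_triples by blast
  ultimately show ?thesis
    using assms(4) set_bools unfolding check_no_singleton_def list_all_iff by blast
qed

lemma classified_one_singleton:
  assumes "p \<noteq> q" "p \<noteq> r" "q \<noteq> r" "lex_less p r"
    "(s0, s2) \<in> set split_sizes" "(s5, s6) \<in> set split_sizes"
  shows "classified (key_adj xy p q r (\<lambda>s. s) (\<lambda>_. ac) (\<lambda>s. s) ka kc)
    (key_slots ka False kc [s0, None, s2, None, Some One, s5, s6])"
proof -
  have "check_one_singleton xy"
    using one_singleton_checked_False one_singleton_checked_True by (cases xy) simp_all
  moreover have "(p, q, r) \<in> set trace_triples"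
    using assms set_trace_triples by blast
  ultimately show ?thesis
    using assms(4-6) set_bools unfolding check_one_singleton_def list_all_iff by blast
qed

lemma classified_two_singletons:
  assumes "p \<noteq> q" "p \<noteq> r" "q \<noteq> r" "lex_less q r"
    "{s0, s1, s2, s3} \<subseteq> set sizes" "\<not> (s0 = None \<and> s1 = None \<and> s2 = None \<and> s3 = None)"
  shows "classified (key_adj xy p q r (\<lambda>s. s) (\<lambda>s. s) (\<lambda>_. bc) ka False)
    (key_slots ka False False [s0, s1, s2, s3, Some One, Some One, None])"
proof -
  have "check_two_singletons xy"
    using two_singletons_checked_False two_singletons_checked_True by (cases xy) simp_all
  moreover have "(p, q, r) \<in> set trace_triples"
    using assms set_trace_triples by blast
  moreover have "s0 \<in> set sizes" "s1 \<in> set sizes" "s2 \<in> set sizes" "s3 \<in> set sizes"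
    using assms(5) by simp_all
  ultimately show ?thesis
    using assms(4,6) set_bools unfolding check_two_singletons_def list_all_iff by blast
qed

section \<open>Cells of a graph probed by two vertices\<close>

locale probed_graph = diam2_graph +
  fixes x y :: 'a
  assumes x_in_V: "x \<in> V" and y_in_V: "y \<in> V" and x_ne_y: "x \<noteq> y"
    and no_co_resolving_4: "\<not> (\<exists>S. co_resolving V E S \<and> card S = 4)"
begin

definition trace :: "'a \<Rightarrow> bool \<times> bool" where
  "trace v = (E x v, E y v)"

definition cell :: "bool \<times> bool \<Rightarrow> 'a set" where
  "cell p = {v \<in> V - {x, y}. trace v = p}"

definition spanning :: "bool \<times> bool \<Rightarrow> bool \<times> bool \<Rightarrow> bool \<times> bool \<Rightarrow> bool" where
  "spanning p q r \<longleftrightarrow> p \<noteq> q \<and> p \<noteq> r \<and> q \<noteq> r \<and> cell p \<noteq> {} \<and> cell q \<noteq> {} \<and> cell r \<noteq> {}"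

lemma spanning_perms:
  assumes "spanning p q r"
  shows "spanning q p r" "spanning r q p" "spanning p r q" "spanning q r p" "spanning r p q"
  using assms unfolding spanning_def by auto

lemma finite_cell: "finite (cell p)"
  unfolding cell_def using finite_V by simp

lemma cell_disjoint: "p \<noteq> q \<Longrightarrow> cell p \<inter> cell q = {}"
  unfolding cell_def by auto

lemma cellD:
  assumes "v \<in> cell p"
  shows "v \<in> V" "v \<noteq> x" "v \<noteq> y" "E x v = fst p" "E y v = snd p" "E v x = fst p" "E v y = snd p" "trace v = p"
  using assms adj_sym[of x v] adj_sym[of y v] unfolding cell_def trace_def by auto

text \<open>The probing vertices stay outside \<open>S\<close>, so only pairs with equal traces need
  a further witness.\<close>

lemma no_separated_4:
  assumes S: "S \<subseteq> V - {x, y}" "card S = 4"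
    and sep: "\<And>u v. u \<in> S \<Longrightarrow> v \<in> S \<Longrightarrow> u \<noteq> v \<Longrightarrow> trace u \<noteq> trace v \<or> (\<exists>w\<in>V - S. E u w \<noteq> E v w)"
  shows False
proof -
  have "\<exists>w\<in>V - S. E u w \<noteq> E v w" if "u \<in> S" "v \<in> S" "u \<noteq> v" for u v
  proof (cases "trace u = trace v")
    case True
    then show ?thesis using sep that by blast
  next
    case False
    then have "E u x \<noteq> E v x \<or> E u y \<noteq> E v y"
      using adj_sym unfolding trace_def by auto
    moreover have "x \<in> V - S" "y \<in> V - S"
      using S x_in_V y_in_V by blast+
    ultimately show ?thesis by blast
  qed
  then have "co_resolving V E S"
    using S unfolding co_resolving_def by blast
  then show False
    using S no_co_resolving_4 by blast
qed

lemma cells_cover: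
  assumes "spanning p q r"
  shows "V - {x, y} = cell p \<union> cell q \<union> cell r"
proof (intro equalityI subsetI)
  fix v assume v: "v \<in> V - {x, y}"
  obtain a b c where abc: "a \<in> cell p" "b \<in> cell q" "c \<in> cell r"
    using assms unfolding spanning_def by blast
  have tr: "trace a = p" "trace b = q" "trace c = r" "p \<noteq> q" "p \<noteq> r" "q \<noteq> r"
    using abc cellD(8) assms unfolding spanning_def by blast+
  show "v \<in> cell p \<union> cell q \<union> cell r"
  proof (rule ccontr)
    assume "v \<notin> cell p \<union> cell q \<union> cell r"
    then have v_tr: "trace v \<noteq> p" "trace v \<noteq> q" "trace v \<noteq> r"
      using v unfolding cell_def by auto
    have sub: "{v, a, b, c} \<subseteq> V - {x, y}"
      using v abc unfolding cell_def by blast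
    have "v \<noteq> a" "v \<noteq> b" "v \<noteq> c" "a \<noteq> b" "a \<noteq> c" "b \<noteq> c"
      using tr v_tr by auto
    then have card: "card {v, a, b, c} = 4"
      by simp
    show False
      using tr v_tr by (intro no_separated_4[OF sub card]) auto
  qed
next
  fix v assume "v \<in> cell p \<union> cell q \<union> cell r"
  then show "v \<in> V - {x, y}"
    unfolding cell_def by blast
qed

lemma cell_split:
  assumes span: "spanning p q r" and uv: "u \<in> cell p" "v \<in> cell p" "u \<noteq> v"
    and w: "w \<noteq> u" "w \<noteq> v" "E u w \<noteq> E v w"
  shows "cell q = {w} \<or> cell r = {w}"
proof (rule ccontr)
  assume "\<not> (cell q = {w} \<or> cell r = {w})"
  then have "\<not> cell q \<subseteq> {w}" "\<not> cell r \<subseteq> {w}"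
    using span unfolding spanning_def by (auto dest: subset_singletonD)
  \<comment> \<open>Representatives other than \<open>w\<close> are chosen so that \<open>w\<close>
    remains outside the four-element set and can separate \<open>u\<close> from
    \<open>v\<close>.\<close>
  then obtain b c where bc: "b \<in> cell q" "b \<noteq> w" "c \<in> cell r" "c \<noteq> w"
    by blast
  have tr: "trace u = p" "trace v = p" "trace b = q" "trace c = r" "p \<noteq> q" "p \<noteq> r" "q \<noteq> r"
    using uv bc cellD(8) span unfolding spanning_def by blast+
  have sub: "{u, v, b, c} \<subseteq> V - {x, y}"
    using uv bc unfolding cell_def by blast
  have "u \<noteq> b" "u \<noteq> c" "v \<noteq> b" "v \<noteq> c" "b \<noteq> c"
    using tr by auto
  then have card: "card {u, v, b, c} = 4"
    using uv(3) by simp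
  have w_in: "w \<in> V - {u, v, b, c}"
    using w(1,2) bc(2,4) w(3) adj_in_V(2)[of u w] adj_in_V(2)[of v w] by auto
  show False
  proof (rule no_separated_4[OF sub card])
    fix s t assume st: "s \<in> {u, v, b, c}" "t \<in> {u, v, b, c}" "s \<noteq> t"
    show "trace s \<noteq> trace t \<or> (\<exists>w\<in>V - {u, v, b, c}. E s w \<noteq> E t w)"
    proof (cases "trace s = trace t")
      case True
      then have "s = u \<and> t = v \<or> s = v \<and> t = u"
        using st tr by auto
      then have "E s w \<noteq> E t w"
        using w(3) by auto
      then show ?thesis
        using w_in by blast
    qed simp
  qed
qed

text \<open>A vertex inside the cell cannot be the sole vertex of another cell, so it never splits
  its own cell; moving endpoints one at a time then makes the cell complete or edgeless.\<close>

lemma cell_inner: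
  assumes span: "spanning p q r"
  shows "\<exists>k. \<forall>u\<in>cell p. \<forall>v\<in>cell p. u \<noteq> v \<longrightarrow> E u v = k"
proof (cases "\<exists>a b. a \<in> cell p \<and> b \<in> cell p \<and> a \<noteq> b")
  case True
  then obtain a b where ab: "a \<in> cell p" "b \<in> cell p" "a \<noteq> b"
    by blast
  have step: "E u w = E v w" if "u \<in> cell p" "v \<in> cell p" "w \<in> cell p" "w \<noteq> u" "w \<noteq> v" for u v w
  proof (rule ccontr)
    assume ne: "E u w \<noteq> E v w"
    then have "u \<noteq> v" by auto
    then have "w \<in> cell q \<or> w \<in> cell r"
      using cell_split[OF span that(1,2) _ that(4,5) ne] by blast
    then show False
      using that(3) span cell_disjoint[of p q] cell_disjoint[of p r] unfolding spanning_def by blast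
  qed
  have "E u v = E a b" if uv: "u \<in> cell p" "v \<in> cell p" "u \<noteq> v" for u v
  proof (cases "v = a")
    case True
    then show ?thesis
      using step[of u b a] uv ab adj_sym by metis
  next
    case False
    then show ?thesis
      using step[of u a v] step[of v b a] uv ab adj_sym by metis
  qed
  then show ?thesis by blast
next
  case False
  then show ?thesis by blast
qed

text \<open>A vertex of a cell with several vertices is not the single element of any cell, so by
  \<open>cell_split\<close> it cannot split another one.\<close>

lemma cell_outer:
  assumes span: "spanning p q r" and uv: "u \<in> cell p" "v \<in> cell p" and w: "w \<in> cell q" "card (cell q) \<noteq> 1"
  shows "E u w = E v w"
proof (rule ccontr)
  assume ne: "E u w \<noteq> E v w"
  have pqr: "p \<noteq> q" "q \<noteq> r"
    using span unfolding spanning_def by blast+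
  then have "w \<noteq> u" "w \<noteq> v"
    using uv w(1) cellD(8) by metis+
  moreover have "u \<noteq> v"
    using ne by auto
  ultimately have "cell q = {w} \<or> cell r = {w}"
    using cell_split[OF span uv] ne by blast
  moreover have "w \<notin> cell r"
    using w(1) cellD(8) pqr(2) by metis
  moreover have "cell q \<noteq> {w}"
    using w(2) by auto
  ultimately show False
    by simp
qed

lemma cell_cross:
  assumes span: "spanning p q r" and card: "card (cell p) \<noteq> 1" "card (cell q) \<noteq> 1"
  shows "\<exists>k. \<forall>u\<in>cell p. \<forall>v\<in>cell q. E u v = k"
proof -
  obtain a b where ab: "a \<in> cell p" "b \<in> cell q"
    using span unfolding spanning_def by blast
  have "E u v = E a b" if "u \<in> cell p" "v \<in> cell q" for u v
    using cell_outer[OF span that(1) ab(1) that(2) card(2)]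
      cell_outer[OF spanning_perms(1)[OF span] that(2) ab(2) ab(1) card(1)] adj_sym by metis
  then show ?thesis by blast
qed

text \<open>\<open>f\<close> and \<open>g\<close> split the cell of \<open>p\<close>, and
  \<open>h\<close> that of \<open>r\<close>; they are taken to be adjacency to a one-element cell,
  or constantly \<open>False\<close> when no splitting occurs.\<close>

definition key_set :: "bool \<times> bool \<Rightarrow> bool \<times> bool \<Rightarrow> bool \<times> bool \<Rightarrow> ('a \<Rightarrow> bool) \<Rightarrow> ('a \<Rightarrow> bool) \<Rightarrow> ('a \<Rightarrow> bool) \<Rightarrow> key \<Rightarrow> 'a set" where
  "key_set p q r f g h i = (case i of KX \<Rightarrow> {x} | KY \<Rightarrow> {y} | KA s t \<Rightarrow> {u \<in> cell p. f u = s \<and> g u = t}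
     | KB \<Rightarrow> cell q | KC s \<Rightarrow> {w \<in> cell r. h w = s})"

text \<open>Common end of the three cases: \<open>ab\<close>, \<open>ac\<close>, \<open>bc\<close>
  turn the flag of a part into its adjacency to another cell, the identity for a splitting cell and
  a constant otherwise.\<close>

lemma classified_cells:
  assumes span: "spanning p q r"
    and ka: "\<forall>u\<in>cell p. \<forall>v\<in>cell p. u \<noteq> v \<longrightarrow> E u v = ka"
    and kb: "\<forall>u\<in>cell q. \<forall>v\<in>cell q. u \<noteq> v \<longrightarrow> E u v = kb"
    and kc: "\<forall>u\<in>cell r. \<forall>v\<in>cell r. u \<noteq> v \<longrightarrow> E u v = kc"
    and ab: "\<forall>u\<in>cell p. \<forall>v\<in>cell q. E u v = ab (f u)"
    and ac: "\<forall>u\<in>cell p. \<forall>w\<in>cell r. E u w = ac (g u)"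
    and bc: "\<forall>v\<in>cell q. \<forall>w\<in>cell r. E v w = bc (h w)"
    and cl: "classified (key_adj (E x y) p q r ab ac bc ka kc)
      (key_slots ka kb kc (map (\<lambda>i. slot_size (key_set p q r f g h i))
        [KA False False, KA False True, KA True False, KA True True, KB, KC False, KC True]))"
  shows "\<exists>s\<in>set structures. has_structure V E s"
proof -
  note ka = ka[rule_format] and kb = kb[rule_format] and kc = kc[rule_format]
    and ab = ab[rule_format] and ac = ac[rule_format] and bc = bc[rule_format]
  define X where "X = key_set p q r f g h"
  have X: "X KX = {x}" "X KY = {y}" "\<And>s t. X (KA s t) = {u \<in> cell p. f u = s \<and> g u = t}"
    "X KB = cell q" "\<And>s. X (KC s) = {w \<in> cell r. h w = s}"
    unfolding X_def key_set_def by simp_all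
  let ?keys = "[KX, KY, KA False False, KA False True, KA True False, KA True True, KB, KC False, KC True]"
  let ?zs = "zip ?keys (zip [False, False, ka, ka, ka, ka, kb, kc, kc] (Some One # Some One #
      map (\<lambda>i. slot_size (X i)) [KA False False, KA False True, KA True False, KA True True, KB, KC False, KC True]))"
  have pqr: "p \<noteq> q" "p \<noteq> r" "q \<noteq> r"
    using span unfolding spanning_def by blast+
  have in_keys: "i \<in> set ?keys" for i
    by (cases i) auto
  have "slotting V E (key_adj (E x y) p q r ab ac bc ka kc) (concat (map slot ?zs)) X"
  proof (rule slotting_slots)
    show "distinct (map fst ?zs)"
      by simp
    show "z = slot_size (X i)" if "(i, k, z) \<in> set ?zs" for i k z
    proof -
      have "slot_size (X KX) = Some One" "slot_size (X KY) = Some One"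
        unfolding slot_size_def X by simp_all
      then show ?thesis
        using that by auto
    qed
    show "E u v = k" if "(i, k, z) \<in> set ?zs" "u \<in> X i" "v \<in> X i" "u \<noteq> v" for i k z u v
      using that ka kb kc by (auto simp: X)
    have keys: "fst ` set ?zs = UNIV"
      using in_keys by (auto simp: set_eq_iff)
    show "V = (\<Union>i\<in>fst ` set ?zs. X i)"
      unfolding keys
    proof (intro equalityI subsetI)
      fix u assume "u \<in> V"
      then consider "u = x" | "u = y" | "u \<in> cell p" | "u \<in> cell q" | "u \<in> cell r"
        using cells_cover[OF span] by blast
      then show "u \<in> (\<Union>i\<in>UNIV. X i)"
      proof cases
        case 1
        then show ?thesis by (intro UN_I[of KX]) (simp_all add: X)
      next
        case 2
        then show ?thesis by (intro UN_I[of KY]) (simp_all add: X)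
      next
        case 3
        then show ?thesis by (intro UN_I[of "KA (f u) (g u)"]) (simp_all add: X)
      next
        case 4
        then show ?thesis by (intro UN_I[of KB]) (simp_all add: X)
      next
        case 5
        then show ?thesis by (intro UN_I[of "KC (h u)"]) (simp_all add: X)
      qed
    next
      fix u assume "u \<in> (\<Union>i\<in>UNIV. X i)"
      then obtain i where "u \<in> X i"
        by blast
      then show "u \<in> V"
        using x_in_V y_in_V cellD(1) by (cases i) (auto simp: X)
    qed
    show "X i \<inter> X j = {}" if "i \<noteq> j" for i j
    proof -
      have "x \<notin> cell s" "y \<notin> cell s" for s
        unfolding cell_def by blast+
      then show ?thesis
        using that x_ne_y cell_disjoint[OF pqr(1)] cell_disjoint[OF pqr(2)] cell_disjoint[OF pqr(3)]
        by (cases i; cases j) (auto simp: X)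
    qed
    show "E u v = key_adj (E x y) p q r ab ac bc ka kc i j" if "i \<noteq> j" "u \<in> X i" "v \<in> X j" for i j u v
    proof -
      have "E u v = ab (f v)" if "u \<in> cell q" "v \<in> cell p" for u v
        using ab[OF that(2,1)] adj_sym by blast
      moreover have "E u v = ac (g v)" if "u \<in> cell r" "v \<in> cell p" for u v
        using ac[OF that(2,1)] adj_sym by blast
      moreover have "E u v = bc (h u)" if "u \<in> cell r" "v \<in> cell q" for u v
        using bc[OF that(2,1)] adj_sym by blast
      \<comment> \<open>Vertices with different flags are distinct, so the constant inner adjacency
        of the cell also holds between its parts.\<close>
      moreover have "E u v = ka" if "u \<in> cell p" "v \<in> cell p" "f u \<noteq> f v \<or> g u \<noteq> g v" for u v
        using ka[OF that(1,2)] that(3) by auto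
      moreover have "E u v = kc" if "u \<in> cell r" "v \<in> cell r" "h u \<noteq> h v" for u v
        using kc[OF that(1,2)] that(3) by auto
      moreover have "E y x = E x y"
        using adj_sym by blast
      ultimately show ?thesis
        using that by (cases i; cases j) (auto simp: X ab ac bc
          cellD(4-7)[of _ p] cellD(4-7)[of _ q] cellD(4-7)[of _ r])
    qed
  qed
  moreover have "concat (map slot ?zs) = key_slots ka kb kc (map (\<lambda>i. slot_size (X i))
      [KA False False, KA False True, KA True False, KA True True, KB, KC False, KC True])"
    unfolding key_slots_def ..
  ultimately have "slotting V E (key_adj (E x y) p q r ab ac bc ka kc) (key_slots ka kb kc (map (\<lambda>i. slot_size (X i))
      [KA False False, KA False True, KA True False, KA True True, KB, KC False, KC True])) X"
    by simp
  then show ?thesis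
  proof (rule classified_has_structure)
    show "classified (key_adj (E x y) p q r ab ac bc ka kc) (key_slots ka kb kc (map (\<lambda>i. slot_size (X i))
      [KA False False, KA False True, KA True False, KA True True, KB, KC False, KC True]))"
      unfolding X_def by (rule cl)
    show "\<exists>w. E u w \<and> E w v" if "u \<in> V" "v \<in> V" "u \<noteq> v" "\<not> E u v" for u v
      using common_neighbour[OF that] by blast
  qed (rule no_co_resolving_4)
qed

lemma no_singleton_structure:
  assumes span: "spanning p q r" and "lex_less q r"
    and card: "card (cell p) \<noteq> 1" "card (cell q) \<noteq> 1" "card (cell r) \<noteq> 1"
  shows "\<exists>s\<in>set structures. has_structure V E s"
proof -
  note perms = spanning_perms[OF span]
  obtain ka where ka: "\<forall>u\<in>cell p. \<forall>v\<in>cell p. u \<noteq> v \<longrightarrow> E u v = ka"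
    using cell_inner[OF span] ..
  obtain kb where kb: "\<forall>u\<in>cell q. \<forall>v\<in>cell q. u \<noteq> v \<longrightarrow> E u v = kb"
    using cell_inner[OF perms(1)] ..
  obtain kc where kc: "\<forall>u\<in>cell r. \<forall>v\<in>cell r. u \<noteq> v \<longrightarrow> E u v = kc"
    using cell_inner[OF perms(2)] ..
  obtain ab where ab: "\<forall>u\<in>cell p. \<forall>v\<in>cell q. E u v = ab"
    using cell_cross[OF span card(1,2)] ..
  obtain ac where ac: "\<forall>u\<in>cell p. \<forall>v\<in>cell r. E u v = ac"
    using cell_cross[OF perms(3) card(1,3)] ..
  obtain bc where bc: "\<forall>u\<in>cell q. \<forall>v\<in>cell r. E u v = bc"
    using cell_cross[OF perms(4) card(2,3)] ..
  let ?X = "key_set p q r (\<lambda>_. False) (\<lambda>_. False) (\<lambda>_. False)"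
  have "?X (KA False False) = cell p" "?X (KA False True) = {}" "?X (KA True False) = {}" "?X (KA True True) = {}"
    "?X KB = cell q" "?X (KC False) = cell r" "?X (KC True) = {}"
    unfolding key_set_def by simp_all
  moreover have "slot_size (cell p) = Some (Many True)" "slot_size (cell q) = Some (Many True)"
    "slot_size (cell r) = Some (Many True)" "slot_size ({} :: 'a set) = None"
    using card span unfolding spanning_def slot_size_def by simp_all
  moreover have "p \<noteq> q" "p \<noteq> r" "q \<noteq> r"
    using span unfolding spanning_def by blast+
  ultimately have cl: "classified (key_adj (E x y) p q r (\<lambda>_. ab) (\<lambda>_. ac) (\<lambda>_. bc) ka kc)
      (key_slots ka kb kc (map (\<lambda>i. slot_size (?X i))
        [KA False False, KA False True, KA True False, KA True True, KB, KC False, KC True]))"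
    using classified_no_singleton[of p q r] assms(2) by simp
  show ?thesis
    by (rule classified_cells[OF span, where ka = ka and kb = kb and kc = kc and ab = "\<lambda>_. ab" and ac = "\<lambda>_. ac"
          and bc = "\<lambda>_. bc" and f = "\<lambda>_. False" and g = "\<lambda>_. False" and h = "\<lambda>_. False"],
        fact ka, fact kb, fact kc, fact ab, fact ac, fact bc, fact cl)
qed

lemma one_singleton_structure:
  assumes span: "spanning p q r" and "lex_less p r"
    and card: "card (cell p) \<noteq> 1" "card (cell q) = 1" "card (cell r) \<noteq> 1"
  shows "\<exists>s\<in>set structures. has_structure V E s"
proof -
  note perms = spanning_perms[OF span]
  obtain b where b: "cell q = {b}"
    using card by (auto simp: card_1_singleton_iff)
  obtain ka where ka: "\<forall>u\<in>cell p. \<forall>v\<in>cell p. u \<noteq> v \<longrightarrow> E u v = ka"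
    using cell_inner[OF span] ..
  obtain kc where kc: "\<forall>u\<in>cell r. \<forall>v\<in>cell r. u \<noteq> v \<longrightarrow> E u v = kc"
    using cell_inner[OF perms(2)] ..
  obtain ac where ac: "\<forall>u\<in>cell p. \<forall>v\<in>cell r. E u v = ac"
    using cell_cross[OF perms(3) card(1,3)] ..
  let ?X = "key_set p q r (E b) (\<lambda>_. False) (E b)"
  have "(slot_size (?X (KA False False)), slot_size (?X (KA True False))) \<in> set split_sizes"
  proof (rule slot_size_split)
    have "?X (KA False False) \<union> ?X (KA True False) = cell p"
      unfolding key_set_def by auto
    then show "finite (?X (KA False False) \<union> ?X (KA True False))" "?X (KA False False) \<union> ?X (KA True False) \<noteq> {}"
      "card (?X (KA False False) \<union> ?X (KA True False)) \<noteq> 1"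
      using finite_cell card span unfolding spanning_def by simp_all
  qed (auto simp: key_set_def)
  moreover have "(slot_size (?X (KC False)), slot_size (?X (KC True))) \<in> set split_sizes"
  proof (rule slot_size_split)
    have "?X (KC False) \<union> ?X (KC True) = cell r"
      unfolding key_set_def by auto
    then show "finite (?X (KC False) \<union> ?X (KC True))" "?X (KC False) \<union> ?X (KC True) \<noteq> {}"
      "card (?X (KC False) \<union> ?X (KC True)) \<noteq> 1"
      using finite_cell card span unfolding spanning_def by simp_all
  qed (auto simp: key_set_def)
  moreover have "slot_size (?X (KA False True)) = None" "slot_size (?X (KA True True)) = None" "slot_size (?X KB) = Some One"
    using b unfolding key_set_def slot_size_def by simp_all
  moreover have "p \<noteq> q" "p \<noteq> r" "q \<noteq> r"
    using span unfolding spanning_def by blast+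
  ultimately have cl: "classified (key_adj (E x y) p q r (\<lambda>s. s) (\<lambda>_. ac) (\<lambda>s. s) ka kc) (key_slots ka False kc (map (\<lambda>i. slot_size (?X i))
      [KA False False, KA False True, KA True False, KA True True, KB, KC False, KC True]))"
    using classified_one_singleton[of p q r] assms(2) by simp
  have kb: "\<forall>u\<in>cell q. \<forall>v\<in>cell q. u \<noteq> v \<longrightarrow> E u v = False"
    using b by simp
  have ab: "\<forall>u\<in>cell p. \<forall>v\<in>cell q. E u v = E b u"
    using b adj_sym by simp
  have bc: "\<forall>v\<in>cell q. \<forall>w\<in>cell r. E v w = E b w"
    using b by simp
  show ?thesis
    by (rule classified_cells[OF span, where ka = ka and kb = False and kc = kc and ab = "\<lambda>s. s" and ac = "\<lambda>_. ac"
          and bc = "\<lambda>s. s" and f = "E b" and g = "\<lambda>_. False" and h = "E b"],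
        fact ka, fact kb, fact kc, fact ab, fact ac, fact bc, fact cl)
qed

lemma two_singletons_structure:
  assumes span: "spanning p q r" and "lex_less q r"
    and card: "card (cell q) = 1" "card (cell r) = 1"
  shows "\<exists>s\<in>set structures. has_structure V E s"
proof -
  obtain b c where b: "cell q = {b}" and c: "cell r = {c}"
    using card by (auto simp: card_1_singleton_iff)
  obtain ka where ka: "\<forall>u\<in>cell p. \<forall>v\<in>cell p. u \<noteq> v \<longrightarrow> E u v = ka"
    using cell_inner[OF span] ..
  let ?X = "key_set p q r (E b) (E c) (\<lambda>_. False)"
  obtain a where "a \<in> cell p"
    using span unfolding spanning_def by blast
  then have "a \<in> ?X (KA (E b a) (E c a))"
    unfolding key_set_def by simp
  then have "slot_size (?X (KA (E b a) (E c a))) \<noteq> None"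
    unfolding slot_size_def by auto
  then have ne: "\<not> (slot_size (?X (KA False False)) = None \<and> slot_size (?X (KA False True)) = None \<and>
      slot_size (?X (KA True False)) = None \<and> slot_size (?X (KA True True)) = None)"
    by (cases "E b a"; cases "E c a") auto
  have pqr: "p \<noteq> q" "p \<noteq> r" "q \<noteq> r"
    using span unfolding spanning_def by blast+
  have "{slot_size (?X (KA False False)), slot_size (?X (KA False True)), slot_size (?X (KA True False)),
      slot_size (?X (KA True True))} \<subseteq> set sizes"
    using slot_size_in_sizes by blast
  note cl = classified_two_singletons[OF pqr assms(2) this ne, of "E x y" "E b c" ka]
  have cl: "classified (key_adj (E x y) p q r (\<lambda>s. s) (\<lambda>s. s) (\<lambda>_. E b c) ka False) (key_slots ka False False (map (\<lambda>i. slot_size (?X i))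
      [KA False False, KA False True, KA True False, KA True True, KB, KC False, KC True]))"
  proof -
    have "slot_size (?X KB) = Some One" "slot_size (?X (KC False)) = Some One" "slot_size (?X (KC True)) = None"
      using b c unfolding key_set_def slot_size_def by simp_all
    then show ?thesis
      using cl by simp
  qed
  have kb: "\<forall>u\<in>cell q. \<forall>v\<in>cell q. u \<noteq> v \<longrightarrow> E u v = False"
    using b by simp
  have kc: "\<forall>u\<in>cell r. \<forall>v\<in>cell r. u \<noteq> v \<longrightarrow> E u v = False"
    using c by simp
  have ab: "\<forall>u\<in>cell p. \<forall>v\<in>cell q. E u v = E b u"
    using b adj_sym by simp
  have ac: "\<forall>u\<in>cell p. \<forall>w\<in>cell r. E u w = E c u"
    using c adj_sym by simp
  have bc: "\<forall>v\<in>cell q. \<forall>w\<in>cell r. E v w = E b c"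
    using b c by simp
  show ?thesis
    by (rule classified_cells[OF span, where ka = ka and kb = False and kc = False and ab = "\<lambda>s. s" and ac = "\<lambda>s. s"
          and bc = "\<lambda>_. E b c" and f = "E b" and g = "E c" and h = "\<lambda>_. False"],
        fact ka, fact kb, fact kc, fact ab, fact ac, fact bc, fact cl)
qed

text \<open>The cells are relabelled so that one-element cells take the roles expected by the three
  cases; the two cells with equal roles are then put in order by \<open>lex_less\<close>.\<close>

lemma spanning_structure:
  assumes span: "spanning p q r"
  shows "\<exists>s\<in>set structures. has_structure V E s"
proof -
  note perms = spanning_perms[OF span]
  have two: ?thesis if "spanning p q r" "card (cell q) = 1" "card (cell r) = 1" for p q r
    using two_singletons_structure[OF that(1)] two_singletons_structure[OF spanning_perms(3)[OF that(1)]] that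
      lex_less_linear[of q r] unfolding spanning_def by blast
  have one: ?thesis if "spanning p q r" "card (cell p) \<noteq> 1" "card (cell q) = 1" "card (cell r) \<noteq> 1" for p q r
    using one_singleton_structure[OF that(1)] one_singleton_structure[OF spanning_perms(2)[OF that(1)]] that
      lex_less_linear[of p r] unfolding spanning_def by blast
  have none: ?thesis if "card (cell p) \<noteq> 1" "card (cell q) \<noteq> 1" "card (cell r) \<noteq> 1"
    using no_singleton_structure[OF span] no_singleton_structure[OF perms(3)] that
      lex_less_linear[of q r] span unfolding spanning_def by blast
  show ?thesis
    using none one[OF span] one[OF perms(1)] one[OF perms(3)] two[OF span] two[OF perms(1)] two[OF perms(5)] 
    by blast
qed

end

context diam2_graph begin

lemma co_resolving_3_structure:
  assumes ex3: "\<exists>S. co_resolving V E S \<and> card S = 3" and no4: "\<not> (\<exists>S. co_resolving V E S \<and> card S = 4)"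
  shows "\<exists>s\<in>set structures. has_structure V E s"
proof -
  obtain S where S: "co_resolving V E S" "card S = 3"
    using ex3 by blast
  then obtain a b c where abc: "S = {a, b, c}" "a \<noteq> b" "a \<noteq> c" "b \<noteq> c"
    by (auto simp: card_3_iff)
  have sub: "a \<in> V" "b \<in> V" "c \<in> V"
    using S abc unfolding co_resolving_def by blast+
  have sep: "\<exists>w\<in>V - S. E u w \<noteq> E v w" if "u \<in> S" "v \<in> S" "u \<noteq> v" for u v
    using S that unfolding co_resolving_def by blast
  obtain x where x: "x \<in> V - S" "E a x \<noteq> E b x"
    using sep abc by blast
  \<comment> \<open>Two probing vertices suffice: on \<open>x\<close>, the vertex \<open>c\<close>
    agrees with exactly one of \<open>a\<close>, \<open>b\<close>, and \<open>y\<close> is chosen to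
    separate \<open>c\<close> from that one. Since \<open>x\<close> does not separate this pair,
    \<open>x \<noteq> y\<close>.\<close>
  obtain y where y: "y \<in> V - S" "(E a x, E a y) \<noteq> (E c x, E c y)" "(E b x, E b y) \<noteq> (E c x, E c y)" "x \<noteq> y"
  proof (cases "E c x = E a x")
    case True
    obtain y where "y \<in> V - S" "E a y \<noteq> E c y"
      using sep abc by blast
    then show ?thesis
      using that True x by (metis prod.inject)
  next
    case False
    obtain y where "y \<in> V - S" "E b y \<noteq> E c y"
      using sep abc by blast
    then show ?thesis
      using that False x by (metis prod.inject)
  qed
  interpret probed_graph V E x y
    by unfold_locales (use x y no4 in auto)
  have "a \<in> cell (trace a)" "b \<in> cell (trace b)" "c \<in> cell (trace c)"
    using x y sub abc(1) unfolding cell_def by auto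
  moreover have "trace a \<noteq> trace b" "trace a \<noteq> trace c" "trace b \<noteq> trace c"
  proof -
    have "trace v = (E v x, E v y)" for v
      unfolding trace_def using adj_sym by auto
    then show "trace a \<noteq> trace b" "trace a \<noteq> trace c" "trace b \<noteq> trace c"
      using x(2) y(2,3) by simp_all
  qed
  ultimately have "spanning (trace a) (trace b) (trace c)"
    unfolding spanning_def by blast
  then show ?thesis
    by (rule spanning_structure)
qed

end

theorem theorem3p1:
  fixes V :: "'a set" and E :: "'a \<Rightarrow> 'a \<Rightarrow> bool"
  assumes "simple_graph V E" and "connected_graph V E" and "diameter_two V E"
  shows "metric_dim V E = card V - 3 \<longleftrightarrow>
    (struct_G1 V E \<or> struct_G2 V E \<or> struct_G3 V E \<or> struct_G4 V E \<or> struct_G5 V E \<or>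
     struct_G6 V E \<or> struct_G7 V E \<or> struct_G8 V E \<or> struct_G9 V E \<or> struct_G10 V E)"
proof -
  interpret diam2_graph V E
    by unfold_locales (use assms in auto)
  show ?thesis
    unfolding metric_dim_iff structures_iff[symmetric]
    using co_resolving_3_structure has_structure_co_resolving by blast
qed

end
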